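(* The smallest order of a ring that is neither NI nor reflexive is $128$. Moreover, up to isomorphism, the complete list of non-NI nonreflexive rings of order $128$ is $$R=\begin{pmatrix} M_2(\mathbb{F}_2) & \begin{pmatrix}\mathbb{F}_2&0\\ \mathbb{F}_2&0\end{pmatrix}\\ 0&\mathbb{F}_2\end{pmatrix},\qquad R^{op},\qquad\text{and}\qquad M_2(\mathbb{F}_2)\oplus U_2(\mathbb{F}_2).$$
   Context: All rings are associative with unity. A ring $R$ is NI if its set $N(R)$ of nilpotent elements is a two-sided ideal (equivalently, $N(R)$ equals the upper nil radical of $R$); reflexive if for all $a,b\in R$, $aRb=0$ implies $bRa=0$. $M_2(\mathbb{F}_2)$ is the full $2\times2$ matrix ring over $\mathbb{F}_2$ and $U_2(\mathbb{F}_2)$ is the ring of upper triangular $2\times2$ matrices over $\mathbb{F}_2$. The ring $R$ in the claim is the formal triangular matrix ring in which $V=\begin{pmatrix}\mathbb{F}_2&0\\ \mathbb{F}_2&0\end{pmatrix}=\left\{\begin{pmatrix} x & 0 \\ y & 0 \end{pmatrix}: x,y\in\mathbb{F}_2\right\}$ is regarded as an $(M_2(\mathbb{F}_2),\mathbb{F}_2)$-bimodule via left matrix multiplication and scalar multiplication, so $V\cong\mathbb{F}_2^2$ (column vectors). $R^{op}$ is the opposite ring of $R$, and $\oplus$ denotes direct product of rings. *)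

theory Defs
  imports
    Jordan_Normal_Form.Matrix
    "HOL-Algebra.QuotRing"
    "HOL-Algebra.Chinese_Remainder"
    "HOL-Library.Z2"
begin

definition nilpotents :: "('a, 'm) ring_scheme \<Rightarrow> 'a set" where
  "nilpotents R = {x \<in> carrier R. \<exists>n::nat. n > 0 \<and> x [^]\<^bsub>R\<^esub> n = \<zero>\<^bsub>R\<^esub>}"

text \<open>The library's \<^const>\<open>ideal\<close> is two-sided.\<close>

definition NI_ring :: "('a, 'm) ring_scheme \<Rightarrow> bool" where
  "NI_ring R \<longleftrightarrow> ring R \<and> ideal (nilpotents R) R"

definition reflexive_ring :: "('a, 'm) ring_scheme \<Rightarrow> bool" where
  "reflexive_ring R \<longleftrightarrow> ring R \<and>
     (\<forall>a\<in>carrier R. \<forall>b\<in>carrier R.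
        (\<forall>r\<in>carrier R. a \<otimes>\<^bsub>R\<^esub> r \<otimes>\<^bsub>R\<^esub> b = \<zero>\<^bsub>R\<^esub>) \<longrightarrow>
        (\<forall>r\<in>carrier R. b \<otimes>\<^bsub>R\<^esub> r \<otimes>\<^bsub>R\<^esub> a = \<zero>\<^bsub>R\<^esub>))"

definition op_ring :: "('a, 'm) ring_scheme \<Rightarrow> ('a, 'm) ring_scheme" where
  "op_ring R = R\<lparr>mult := \<lambda>x y. y \<otimes>\<^bsub>R\<^esub> x\<rparr>"

text \<open>
  The formal triangular matrix ring with diagonal entries from the rings \<open>A\<close> and \<open>B\<close> and upper
  right entry from the \<open>(A, B)\<close>-bimodule \<open>V\<close>, whose actions are \<open>l\<close> (left) and \<open>r\<close> (right). The
  triple \<open>(a, v, b)\<close> stands for the matrix with rows \<open>(a, v)\<close> and \<open>(0, b)\<close>.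
  Only the additive part of the record \<open>V\<close> is used.
\<close>

definition formal_triangular_ring ::
  "('a, 'm) ring_scheme \<Rightarrow> ('v, 'n) ring_scheme \<Rightarrow> ('b, 'k) ring_scheme \<Rightarrow>
   ('a \<Rightarrow> 'v \<Rightarrow> 'v) \<Rightarrow> ('v \<Rightarrow> 'b \<Rightarrow> 'v) \<Rightarrow> ('a \<times> 'v \<times> 'b) ring" where
  "formal_triangular_ring A V B l r = \<lparr>
     carrier = carrier A \<times> carrier V \<times> carrier B,
     mult = (\<lambda>(a, v, b) (a', v', b').
               (a \<otimes>\<^bsub>A\<^esub> a', l a v' \<oplus>\<^bsub>V\<^esub> r v b', b \<otimes>\<^bsub>B\<^esub> b')),
     one = (\<one>\<^bsub>A\<^esub>, \<zero>\<^bsub>V\<^esub>, \<one>\<^bsub>B\<^esub>),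
     zero = (\<zero>\<^bsub>A\<^esub>, \<zero>\<^bsub>V\<^esub>, \<zero>\<^bsub>B\<^esub>),
     add = (\<lambda>(a, v, b) (a', v', b').
              (a \<oplus>\<^bsub>A\<^esub> a', v \<oplus>\<^bsub>V\<^esub> v', b \<oplus>\<^bsub>B\<^esub> b'))\<rparr>"

text \<open>The field with two elements is the type \<^typ>\<open>bit\<close>.\<close>

definition F2 :: "bit ring" where
  "F2 = \<lparr>carrier = UNIV, mult = (*), one = 1, zero = 0, add = (+)\<rparr>"

definition M2_F2 :: "bit mat ring" where
  "M2_F2 = ring_mat TYPE(bit) 2 ()"

definition U2_F2 :: "bit mat ring" where
  "U2_F2 = M2_F2\<lparr>carrier := {A \<in> carrier_mat 2 2. upper_triangular A}\<rparr>"

text \<open>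
  The \<open>2 \<times> 2\<close> matrices with zero second column. Only the additive group is meant: the unit
  inherited from \<^const>\<open>M2_F2\<close> does not lie in the carrier.
\<close>

definition V_F2 :: "bit mat ring" where
  "V_F2 = M2_F2\<lparr>carrier := {A \<in> carrier_mat 2 2. \<forall>i<2. A $$ (i, 1) = 0}\<rparr>"

definition T_F2 :: "(bit mat \<times> bit mat \<times> bit) ring" where
  "T_F2 = formal_triangular_ring M2_F2 V_F2 F2 (\<lambda>A v. A * v) (\<lambda>v c. c \<cdot>\<^sub>m v)"

end

theory Submission
  imports Defs
begin

text \<open>
  In a finite ring that is not NI some product \<open>r m\<close> is not nilpotent although \<open>R m\<^sup>2\<close> is nil; an
  idempotent power of \<open>r m\<close> then extends to a \<open>2 \<times> 2\<close> system of matrix units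
  \<open>f = e\<^sub>1\<^sub>1, g = e\<^sub>2\<^sub>2, \<dots>\<close>. With \<open>h = 1 - f - g\<close>, the Peirce decomposition gives
  \<open>|R| = |fRf|\<^sup>4 |fRh|\<^sup>2 |hRf|\<^sup>2 |hRh|\<close>. If \<open>fRh\<close> is nonzero, then \<open>|R| \<ge> 128\<close>, and equality determines
  the multiplication table to be that of \<open>T_F2\<close>; the case \<open>hRf \<noteq> 0\<close> is dual. If both vanish, then
  \<open>R\<close> is the product of \<open>M\<^sub>2(fRf)\<close>, which is prime when \<open>|R| \<le> 128\<close>, and of the ring \<open>hRh\<close>, which
  therefore is not reflexive. A noncommutative ring has at least eight elements, and one of order eight
  that is not reflexive consists of the upper triangular matrices over the field with two elements.
\<close>

section \<open>Matrix units in finite rings that are not NI\<close>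

text \<open>Failure of NI only supplies a nilpotent \<open>n\<close> and a product
  \<open>r n\<close> that is not nilpotent. The obvious candidates for \<open>e12\<close> and
  \<open>e21\<close> then multiply to \<open>f - z\<close> instead of \<open>f\<close>. Passing to a
  power \<open>m\<close> of \<open>n\<close> for which every \<open>s m^2\<close> is nilpotent makes
  the defect \<open>z\<close> nilpotent, so \<open>1 - z\<close> can be inverted and the defect
  divided out. Characteristic 2 is not given either and comes from counting: a component with
  exactly two elements is \<open>{0, x}\<close>, which forces \<open>x + x = 0\<close>, and a
  noncommutative ring of order eight has no central elements besides 0 and 1. The number 128 arises
  in two ways: as \<open>2^4 * 2^2 * 1 * 2\<close> when one off-diagonal component survives, and as
  \<open>2^4 * 8\<close> when none does. In both cases all factors are as small as possible, which
  leaves no freedom. The isomorphisms run from the concrete ring to \<open>R\<close>, with bits as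
  coordinates: injectivity amounts to reading off coefficients, and surjectivity follows from equal
  orders.\<close>

context ring
begin

text \<open>Rests on \<open>(y x)^(n+1) = y (x y)^n x\<close>. It turns left absorption into right
  absorption and lets an outer factor of a product be moved to the other end.\<close>

lemma nilpotents_swap:
  assumes "x \<in> carrier R" "y \<in> carrier R" "x \<otimes> y \<in> nilpotents R"
  shows "y \<otimes> x \<in> nilpotents R"
proof -
  obtain n :: nat where n: "n > 0" "(x \<otimes> y) [^] n = \<zero>"
    using assms(3) by (auto simp: nilpotents_def)
  have "(y \<otimes> x) [^] Suc n = y \<otimes> (x \<otimes> y) [^] n \<otimes> x" for n :: nat
    by (induction n) (use assms(1,2) in \<open>simp_all add: m_assoc\<close>)
  with n(2) have "(y \<otimes> x) [^] Suc n = \<zero>"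
    using assms(1,2) by simp
  then show ?thesis
    unfolding nilpotents_def using assms(1,2) by blast
qed

text \<open>The inverse is the geometric series \<open>1 + z + ... + z^(n-1)\<close>; the induction
  builds it together with its telescoping identity.\<close>

lemma one_minus_nilpotent_left_inverse:
  assumes "z \<in> nilpotents R"
  obtains u where "u \<in> carrier R" "u \<otimes> (\<one> \<ominus> z) = \<one>"
proof -
  from assms obtain n :: nat where z: "z \<in> carrier R" and n: "z [^] n = \<zero>"
    by (auto simp: nilpotents_def)
  have "\<exists>u\<in>carrier R. u \<otimes> (\<one> \<ominus> z) = \<one> \<ominus> z [^] n" for n :: nat
  proof (induction n)
    case 0
    show ?case
      using z by (intro bexI[of _ "\<zero>"]) (simp_all add: minus_eq r_neg)
  next
    case (Suc n)
    then obtain u where u: "u \<in> carrier R" "u \<otimes> (\<one> \<ominus> z) = \<one> \<ominus> z [^] n"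
      by blast
    have "(u \<oplus> z [^] n) \<otimes> (\<one> \<ominus> z) = (\<one> \<ominus> z [^] n) \<oplus> z [^] n \<otimes> (\<one> \<ominus> z)"
      using u z by (simp add: l_distr)
    also have "\<dots> = \<one> \<ominus> z [^] n \<oplus> (z [^] n \<ominus> z [^] Suc n)"
      using z by (simp add: minus_eq r_distr r_minus)
    also have "\<dots> = \<one> \<ominus> z [^] Suc n"
      using z by (simp add: minus_eq a_assoc) (simp add: l_neg flip: a_assoc)
    finally show ?case
      using u(1) z by blast
  qed
  from this[of n] that show thesis
    using z by (auto simp: n minus_eq)
qed

lemma idempotent_power:
  assumes "finite (carrier R)" "x \<in> carrier R"
  obtains k :: nat where "k > 0" "x [^] k \<otimes> x [^] k = x [^] k"
proof -
  have "\<not> inj (\<lambda>i::nat. x [^] i)"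
    using assms by (metis finite_subset image_subsetI nat_pow_closed finite_imageD infinite_UNIV_nat)
  then obtain i j :: nat where "i < j" "x [^] i = x [^] j"
    unfolding inj_def by (metis linorder_neqE_nat)
  then obtain p where p: "p > 0" "x [^] (i + p) = x [^] i"
    by (metis less_imp_add_positive)
  have step: "x [^] (n + p) = x [^] n" if "n \<ge> i" for n
  proof -
    have "x [^] (n + p) = x [^] (i + p) \<otimes> x [^] (n - i)"
      using that assms(2) by (simp add: nat_pow_mult add.commute)
    also have "\<dots> = x [^] n"
      using that assms(2) p(2) by (simp add: nat_pow_mult add.commute)
    finally show ?thesis .
  qed
  have mult: "x [^] (n + t * p) = x [^] n" if "n \<ge> i" for n t
  proof (induction t)
    case (Suc t)
    with step[of "n + t * p"] that show ?case
      by (simp add: algebra_simps)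
  qed simp
  \<comment> \<open>The exponent has to be a multiple of the period \<open>p\<close> and at least
    the preperiod \<open>i\<close>; the factor \<open>Suc i\<close> keeps it positive when
    \<open>i = 0\<close>.\<close>
  have "Suc i * p \<ge> i"
    using p(1) by (cases p) auto
  then have "x [^] (Suc i * p) \<otimes> x [^] (Suc i * p) = x [^] (Suc i * p)"
    using mult[of "Suc i * p" "Suc i"] assms(2) by (simp add: nat_pow_mult)
  with p(1) that[of "Suc i * p"] show thesis
    by simp
qed

text \<open>The exponent has the form \<open>Suc k\<close> so that one factor \<open>x\<close> can
  be split off the idempotent.\<close>

lemma idempotent_power_nonzero:
  assumes "finite (carrier R)" "x \<in> carrier R" "x \<notin> nilpotents R"
  obtains k :: nat where "x [^] Suc k \<noteq> \<zero>" "x [^] Suc k \<otimes> x [^] Suc k = x [^] Suc k"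
proof -
  obtain k :: nat where "k > 0" "x [^] k \<otimes> x [^] k = x [^] k"
    using idempotent_power assms by blast
  moreover from this assms(2,3) have "x [^] k \<noteq> \<zero>"
    unfolding nilpotents_def by blast
  ultimately show thesis
    using that[of "k - 1"] by simp
qed

text \<open>If a power \<open>f\<close> of \<open>x + y\<close> were a nonzero idempotent, then \<open>f\<close> would be the sum of two
  nilpotent elements of the corner ring \<open>f R f\<close>, one of them being a unit there.\<close>

lemma nilpotents_add_closed:
  assumes fin: "finite (carrier R)"
    and absorb: "\<And>n r. n \<in> nilpotents R \<Longrightarrow> r \<in> carrier R \<Longrightarrow> r \<otimes> n \<in> nilpotents R"
    and x: "x \<in> nilpotents R" and y: "y \<in> nilpotents R"
  shows "x \<oplus> y \<in> nilpotents R"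
proof (rule ccontr)
  assume contr: "x \<oplus> y \<notin> nilpotents R"
  have [simp]: "x \<in> carrier R" "y \<in> carrier R"
    using x y by (auto simp: nilpotents_def)
  obtain k :: nat where k: "(x \<oplus> y) [^] Suc k \<noteq> \<zero>"
    "(x \<oplus> y) [^] Suc k \<otimes> (x \<oplus> y) [^] Suc k = (x \<oplus> y) [^] Suc k"
    using idempotent_power_nonzero[OF fin _ contr] by auto
  define c where "c = (x \<oplus> y) [^] k"
  define f where "f = c \<otimes> (x \<oplus> y)"
  have [simp]: "c \<in> carrier R" "f \<in> carrier R"
    by (simp_all add: c_def f_def)
  have f0: "f \<noteq> \<zero>" and ff: "f \<otimes> f = f"
    using k by (simp_all add: f_def c_def)
  have ff': "f \<otimes> (f \<otimes> v) = f \<otimes> v" if "v \<in> carrier R" for v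
    using that ff by (metis \<open>f \<in> carrier R\<close> m_assoc)
  define p where "p = f \<otimes> (c \<otimes> x) \<otimes> f"
  define q where "q = f \<otimes> (c \<otimes> y) \<otimes> f"
  have [simp]: "p \<in> carrier R" "q \<in> carrier R"
    by (simp_all add: p_def q_def)
  have pq: "p \<oplus> q = f"
  proof -
    have "p \<oplus> q = f \<otimes> (c \<otimes> (x \<oplus> y)) \<otimes> f"
      by (simp add: p_def q_def l_distr r_distr)
    then show ?thesis
      by (simp add: ff flip: f_def)
  qed
  \<comment> \<open>Moving the last \<open>f\<close> to the front leaves \<open>f c v\<close>, a
    left multiple of the nilpotent \<open>v\<close>.\<close>
  have nil: "f \<otimes> (c \<otimes> v) \<otimes> f \<in> nilpotents R" if "v \<in> nilpotents R" for v
  proof (rule nilpotents_swap)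
    have [simp]: "v \<in> carrier R"
      using that by (auto simp: nilpotents_def)
    then show "f \<otimes> (f \<otimes> (c \<otimes> v)) \<in> nilpotents R"
      using absorb[OF that, of "f \<otimes> c"] by (simp add: ff' m_assoc)
    show "f \<otimes> (c \<otimes> v) \<in> carrier R"
      by simp
  qed simp
  obtain u where [simp]: "u \<in> carrier R" and u: "u \<otimes> (\<one> \<ominus> p) = \<one>"
    using one_minus_nilpotent_left_inverse nil[OF x] unfolding p_def by blast
  have pf: "p \<otimes> f = p" and qf: "f \<otimes> q = q"
    using ff by (simp_all add: p_def q_def m_assoc ff')
  have "q = f \<ominus> p"
    using pq by (metis \<open>p \<in> carrier R\<close> \<open>q \<in> carrier R\<close> a_comm add.inv_solve_right minus_eq
        \<open>f \<in> carrier R\<close>)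
  also have "\<dots> = (\<one> \<ominus> p) \<otimes> f"
    by (simp add: minus_eq l_distr l_minus pf)
  finally have uq: "u \<otimes> q = f"
    by (metis u m_assoc l_one \<open>u \<in> carrier R\<close> \<open>p \<in> carrier R\<close> \<open>f \<in> carrier R\<close> one_closed minus_closed)
  \<comment> \<open>The relation \<open>u q = f\<close> iterates because \<open>f q = q\<close>. A
    vanishing power of \<open>q\<close> would therefore make \<open>f\<close> vanish.\<close>
  have "u [^] Suc n \<otimes> q [^] Suc n = f" for n :: nat
  proof (induction n)
    case (Suc n)
    have "u [^] Suc (Suc n) \<otimes> q [^] Suc (Suc n) = u \<otimes> (u [^] Suc n \<otimes> q [^] Suc n) \<otimes> q"
      by (subst nat_pow_Suc2) (simp_all add: m_assoc)
    then show ?case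
      by (simp only: Suc) (simp add: m_assoc qf uq)
  qed (simp add: uq)
  moreover obtain n :: nat where "n > 0" "q [^] n = \<zero>"
    using nil[OF y] by (auto simp: nilpotents_def q_def)
  ultimately have "f = \<zero>"
    by (metis Suc_pred nat_pow_closed r_null \<open>u \<in> carrier R\<close>)
  with f0 show False
    by simp
qed

text \<open>Left absorption already gives the rest of the ideal property: right absorption by
  swapping factors, negatives by multiplying with \<open>-1\<close>, and sums by the preceding
  lemma, where finiteness enters.\<close>

lemma NI_ringI:
  assumes fin: "finite (carrier R)"
    and absorb: "\<And>n r. n \<in> nilpotents R \<Longrightarrow> r \<in> carrier R \<Longrightarrow> r \<otimes> n \<in> nilpotents R"
  shows "NI_ring R"
proof -
  have car: "n \<in> nilpotents R \<Longrightarrow> n \<in> carrier R" for n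
    by (auto simp: nilpotents_def)
  have "ideal (nilpotents R) R"
  proof (rule idealI)
    show "ring R"
      by (rule ring_axioms)
    show "subgroup (nilpotents R) (add_monoid R)"
    proof (rule add.subgroupI)
      show "nilpotents R \<noteq> {}"
        by (auto simp: nilpotents_def intro!: exI[of _ "\<zero>"] exI[of _ "1::nat"])
      show "\<ominus> n \<in> nilpotents R" if "n \<in> nilpotents R" for n
        using absorb[OF that, of "\<ominus> \<one>"] car[OF that] by (simp add: l_minus)
      show "m \<oplus> n \<in> nilpotents R" if "m \<in> nilpotents R" "n \<in> nilpotents R" for m n
        using nilpotents_add_closed[OF fin absorb that] .
    qed (use car in blast)
    show "n \<otimes> r \<in> nilpotents R" if "n \<in> nilpotents R" "r \<in> carrier R" for n r
      using nilpotents_swap absorb that car by blast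
  qed (rule absorb)
  then show ?thesis
    by (simp add: NI_ring_def ring_axioms)
qed

text \<open>Take \<open>m = n^(i+1)\<close> at the point where some left multiple of
  \<open>n^(i+1)\<close> is not nilpotent but all left multiples of \<open>n^(i+2)\<close> are. Then
  \<open>m^2 = n^i n^(i+2)\<close>.\<close>

lemma not_NI_square:
  assumes "finite (carrier R)" "\<not> NI_ring R"
  obtains m r where "m \<in> carrier R" "r \<in> carrier R" "r \<otimes> m \<notin> nilpotents R"
    "\<And>s. s \<in> carrier R \<Longrightarrow> s \<otimes> (m \<otimes> m) \<in> nilpotents R"
proof -
  obtain n r where n: "n \<in> nilpotents R" "r \<in> carrier R" "r \<otimes> n \<notin> nilpotents R"
    using NI_ringI assms by blast
  then have nc: "n \<in> carrier R"
    by (auto simp: nilpotents_def)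
  define P where "P = (\<lambda>i::nat. \<exists>s\<in>carrier R. s \<otimes> n [^] Suc i \<notin> nilpotents R)"
  have "P 0"
    using n nc by (auto simp: P_def)
  moreover obtain l :: nat where "l > 0" "n [^] l = \<zero>"
    using n(1) by (auto simp: nilpotents_def)
  then have "\<not> P l"
    using nc by (auto simp: P_def nilpotents_def intro: exI[of _ "1::nat"])
  ultimately obtain i where i: "P i" "\<not> P (Suc i)"
    by (metis (full_types) nat_induct)
  from i(1) obtain s where s: "s \<in> carrier R" "s \<otimes> n [^] Suc i \<notin> nilpotents R"
    by (auto simp: P_def)
  have "t \<otimes> (n [^] Suc i \<otimes> n [^] Suc i) \<in> nilpotents R" if "t \<in> carrier R" for t
  proof -
    have "n [^] Suc i \<otimes> n [^] Suc i = n [^] i \<otimes> n [^] Suc (Suc i)"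
      using nc by (simp only: nat_pow_mult) simp
    then have "t \<otimes> (n [^] Suc i \<otimes> n [^] Suc i) = (t \<otimes> n [^] i) \<otimes> n [^] Suc (Suc i)"
      using nc that by (simp only: m_assoc nat_pow_closed)
    also have "\<dots> \<in> nilpotents R"
      using i(2) that nc by (auto simp: P_def simp del: nat_pow_Suc)
    finally show ?thesis .
  qed
  with s nc that[of "n [^] Suc i" s] show thesis
    by blast
qed

text \<open>With the idempotent \<open>f = s m\<close>, the off-diagonal parts
  \<open>(1 - f) m f\<close> and \<open>f s (1 - f)\<close> have product
  \<open>f s m f - f s f m f = f - z\<close>. The nilpotent defect \<open>z\<close> is removed by a
  left inverse \<open>u\<close> of \<open>1 - z\<close>.\<close>

lemma not_NI_matrix_units:
  assumes fin: "finite (carrier R)" and "\<not> NI_ring R"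
  obtains f a b where "f \<in> carrier R" "a \<in> carrier R" "b \<in> carrier R" "f \<noteq> \<zero>" "f \<otimes> f = f"
    "b \<otimes> a = f" "a \<otimes> f = a" "f \<otimes> b = b" "f \<otimes> a = \<zero>" "b \<otimes> f = \<zero>"
proof -
  obtain m r where [simp]: "m \<in> carrier R" "r \<in> carrier R" and rm: "r \<otimes> m \<notin> nilpotents R"
    and mm: "\<And>s. s \<in> carrier R \<Longrightarrow> s \<otimes> (m \<otimes> m) \<in> nilpotents R"
    using not_NI_square assms by blast
  obtain k :: nat where k: "(r \<otimes> m) [^] Suc k \<noteq> \<zero>"
    "(r \<otimes> m) [^] Suc k \<otimes> (r \<otimes> m) [^] Suc k = (r \<otimes> m) [^] Suc k"
    using idempotent_power_nonzero[OF fin _ rm] by auto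
  define s where "s = (r \<otimes> m) [^] k \<otimes> r"
  define f where "f = s \<otimes> m"
  have [simp]: "s \<in> carrier R" "f \<in> carrier R"
    by (simp_all add: s_def f_def)
  have "(r \<otimes> m) [^] Suc k = f"
    by (simp add: f_def s_def m_assoc)
  with k have f0: "f \<noteq> \<zero>" and ff: "f \<otimes> f = f"
    by simp_all
  have ff': "f \<otimes> (f \<otimes> v) = f \<otimes> v" if "v \<in> carrier R" for v
    using that ff by (metis \<open>f \<in> carrier R\<close> m_assoc)
  define z where "z = f \<otimes> s \<otimes> f \<otimes> m \<otimes> f"
  have [simp]: "z \<in> carrier R"
    by (simp add: z_def)
  \<comment> \<open>Replacing the middle \<open>f\<close> by \<open>s m\<close> brings the two
    factors \<open>m\<close> together, so that the choice of \<open>m\<close> applies.\<close>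
  have "z = f \<otimes> s \<otimes> s \<otimes> (m \<otimes> m) \<otimes> f"
    by (simp add: z_def f_def m_assoc)
  also have "\<dots> \<in> nilpotents R"
    by (rule nilpotents_swap) (use mm[of "f \<otimes> (f \<otimes> s \<otimes> s)"] in \<open>simp_all add: m_assoc\<close>)
  finally obtain u where [simp]: "u \<in> carrier R" and u: "u \<otimes> (\<one> \<ominus> z) = \<one>"
    using one_minus_nilpotent_left_inverse by blast
  have zf: "z \<otimes> f = z" and fz: "f \<otimes> z = z"
    using ff by (simp_all add: z_def m_assoc ff')
  \<comment> \<open>The extra factor \<open>f u\<close> in \<open>b\<close> corrects the product:
    \<open>f u (f - z) = f u (1 - z) f = f\<close>.\<close>
  define a where "a = (\<one> \<ominus> f) \<otimes> m \<otimes> f"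
  define b where "b = f \<otimes> u \<otimes> (f \<otimes> s \<otimes> (\<one> \<ominus> f))"
  have fl: "f \<otimes> (\<one> \<ominus> f) = \<zero>" and fr: "(\<one> \<ominus> f) \<otimes> f = \<zero>"
    by (simp_all add: minus_eq r_distr l_distr r_minus l_minus ff r_neg)
  then have ll: "(\<one> \<ominus> f) \<otimes> (\<one> \<ominus> f) = \<one> \<ominus> f"
    by (simp add: minus_eq r_distr r_minus)
  have [simp]: "a \<in> carrier R" "b \<in> carrier R"
    by (simp_all add: a_def b_def)
  have af: "a \<otimes> f = a"
    by (simp add: a_def m_assoc ff)
  have fb: "f \<otimes> b = b"
    by (simp add: b_def m_assoc ff')
  have fa: "f \<otimes> a = \<zero>"
    by (simp add: a_def flip: m_assoc) (simp add: fl)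
  have bf: "b \<otimes> f = \<zero>"
    by (simp add: b_def m_assoc fr)
  have "f \<otimes> s \<otimes> (\<one> \<ominus> f) \<otimes> ((\<one> \<ominus> f) \<otimes> m \<otimes> f) = f \<otimes> s \<otimes> ((\<one> \<ominus> f) \<otimes> (\<one> \<ominus> f)) \<otimes> m \<otimes> f"
    by (simp add: m_assoc)
  also have "\<dots> = f \<otimes> s \<otimes> (\<one> \<ominus> f) \<otimes> m \<otimes> f"
    by (simp add: ll)
  also have "\<dots> = f \<otimes> (s \<otimes> m) \<otimes> f \<ominus> z"
    by (simp add: z_def minus_eq r_distr l_distr r_minus l_minus m_assoc)
  also have "\<dots> = f \<ominus> z"
    by (simp add: ff flip: f_def)
  finally have "b \<otimes> a = f \<otimes> u \<otimes> (f \<ominus> z)"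
    by (simp add: a_def b_def m_assoc)
  also have "f \<ominus> z = (\<one> \<ominus> z) \<otimes> f"
    by (simp add: minus_eq l_distr l_minus zf)
  also have "f \<otimes> u \<otimes> ((\<one> \<ominus> z) \<otimes> f) = f \<otimes> (u \<otimes> (\<one> \<ominus> z)) \<otimes> f"
    by (simp add: m_assoc)
  also have "\<dots> = f"
    by (simp add: u ff)
  finally have ba: "b \<otimes> a = f" .
  from that[of f a b] f0 ff ba af fb fa bf show thesis
    by simp
qed

end

section \<open>Peirce decomposition\<close>

definition peirce :: "('a, 'm) ring_scheme \<Rightarrow> 'a \<Rightarrow> 'a \<Rightarrow> 'a set" where
  "peirce R p q = (\<lambda>s. p \<otimes>\<^bsub>R\<^esub> s \<otimes>\<^bsub>R\<^esub> q) ` carrier R"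

text \<open>A \<open>2 \<times> 2\<close> system of matrix units \<open>e\<^sub>1\<^sub>1 = f\<close>, \<open>e\<^sub>2\<^sub>1 = a\<close>, \<open>e\<^sub>1\<^sub>2 = b\<close>, \<open>e\<^sub>2\<^sub>2 = g\<close> in a
  corner of \<open>R\<close>, with complementary idempotent \<open>h\<close>.\<close>

locale matrix_units = ring R for R (structure) +
  fixes f a b
  assumes units_closed [simp]: "f \<in> carrier R" "a \<in> carrier R" "b \<in> carrier R"
    and f_nonzero: "f \<noteq> \<zero>"
    and ff: "f \<otimes> f = f" and ba: "b \<otimes> a = f" and af: "a \<otimes> f = a" and fb: "f \<otimes> b = b"
    and fa: "f \<otimes> a = \<zero>" and bf: "b \<otimes> f = \<zero>"
begin

definition g where "g = a \<otimes> b"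
definition h where "h = \<one> \<ominus> (f \<oplus> g)"

lemma gh_closed [simp]: "g \<in> carrier R" "h \<in> carrier R"
  by (simp_all add: g_def h_def)

text \<open>In right-nested products a rule for \<open>x \<otimes> y\<close> does not match inside
  \<open>x \<otimes> (y \<otimes> v)\<close>. Every multiplication table below is therefore also
  supplied in this second form.\<close>

lemma mult_assoc_rule:
  assumes "x \<otimes> y = z" "x \<in> carrier R" "y \<in> carrier R" "v \<in> carrier R"
  shows "x \<otimes> (y \<otimes> v) = z \<otimes> v"
  using assms by (simp flip: m_assoc)

lemma aa: "a \<otimes> a = \<zero>"
  by (metis af fa m_assoc r_null units_closed(1,2))

lemma bb: "b \<otimes> b = \<zero>"
  by (metis fb bf m_assoc l_null units_closed(1,3))

lemma units_mult:
  "f \<otimes> f = f" "f \<otimes> b = b" "f \<otimes> a = \<zero>" "f \<otimes> g = \<zero>"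
  "b \<otimes> f = \<zero>" "b \<otimes> b = \<zero>" "b \<otimes> a = f" "b \<otimes> g = b"
  "a \<otimes> f = a" "a \<otimes> b = g" "a \<otimes> a = \<zero>" "a \<otimes> g = \<zero>"
  "g \<otimes> f = \<zero>" "g \<otimes> b = \<zero>" "g \<otimes> a = a" "g \<otimes> g = g"
  by (simp_all add: g_def ff fb fa bf bb ba af aa m_assoc
      mult_assoc_rule[OF ff] mult_assoc_rule[OF fa] mult_assoc_rule[OF ba] mult_assoc_rule[OF aa])

lemma h_mult:
  "f \<otimes> h = \<zero>" "b \<otimes> h = \<zero>" "a \<otimes> h = \<zero>" "g \<otimes> h = \<zero>"
  "h \<otimes> f = \<zero>" "h \<otimes> b = \<zero>" "h \<otimes> a = \<zero>" "h \<otimes> g = \<zero>"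
  by (simp_all add: h_def minus_eq minus_add r_distr l_distr r_minus l_minus units_mult r_neg)

lemma hh: "h \<otimes> h = h"
proof -
  have "h \<otimes> h = h \<otimes> \<one> \<ominus> (h \<otimes> f \<oplus> h \<otimes> g)"
    by (subst (2) h_def) (simp add: minus_eq minus_add r_distr r_minus)
  then show ?thesis
    by (simp add: h_mult minus_eq)
qed

lemmas peirce_mult = units_mult h_mult hh

lemmas peirce_mult' = peirce_mult[THEN mult_assoc_rule]

lemma decompose_one: "f \<oplus> g \<oplus> h = \<one>"
  by (simp add: h_def minus_eq) (metis a_closed a_lcomm gh_closed(1) minus_closed minus_eq one_closed
      r_neg r_zero units_closed(1) a_inv_closed)

lemma decompose_left: "s \<in> carrier R \<Longrightarrow> f \<otimes> s \<oplus> a \<otimes> (b \<otimes> s) \<oplus> h \<otimes> s = s"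
  using decompose_one by (simp add: peirce_mult' flip: l_distr)

lemma decompose_right: "s \<in> carrier R \<Longrightarrow> s \<otimes> f \<oplus> s \<otimes> a \<otimes> b \<oplus> s \<otimes> h = s"
  using decompose_one by (simp add: peirce_mult m_assoc flip: r_distr)

text \<open>Left multiplication by \<open>b\<close> maps \<open>g S\<close> bijectively onto
  \<open>f S\<close>, with inverse given by \<open>a\<close>. Hence \<open>S\<close> is additively
  \<open>f S + a (f S) + h S\<close>, and \<open>f S\<close> counts twice.\<close>

lemma card_left_ideal_decompose:
  assumes "S \<subseteq> carrier R" and add: "\<And>x y. x \<in> S \<Longrightarrow> y \<in> S \<Longrightarrow> x \<oplus> y \<in> S"
    and mult: "\<And>r x. r \<in> carrier R \<Longrightarrow> x \<in> S \<Longrightarrow> r \<otimes> x \<in> S"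
  shows "card S = card ((\<lambda>s. f \<otimes> s) ` S) ^ 2 * card ((\<lambda>s. h \<otimes> s) ` S)"
proof -
  let ?F = "(\<lambda>s. f \<otimes> s) ` S" and ?H = "(\<lambda>s. h \<otimes> s) ` S"
  have sub: "x \<in> carrier R" if "x \<in> S" for x
    using assms that by blast
  have "bij_betw (\<lambda>(x, y, z). x \<oplus> a \<otimes> y \<oplus> z) (?F \<times> ?F \<times> ?H) S"
  proof (rule bij_betw_byWitness[where f' = "\<lambda>s. (f \<otimes> s, b \<otimes> s, h \<otimes> s)"])
    show "\<forall>s\<in>S. (case (f \<otimes> s, b \<otimes> s, h \<otimes> s) of (x, y, z) \<Rightarrow> x \<oplus> a \<otimes> y \<oplus> z) = s"
      using decompose_left sub by auto
    show "(\<lambda>s. (f \<otimes> s, b \<otimes> s, h \<otimes> s)) ` S \<subseteq> ?F \<times> ?F \<times> ?H"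
    proof -
      have "b \<otimes> s \<in> ?F" if "s \<in> S" for s
        using that sub mult by (intro image_eqI[of _ _ "b \<otimes> s"]) (simp_all add: peirce_mult')
      then show ?thesis
        by auto
    qed
  qed (auto simp: sub add mult r_distr peirce_mult')
  then have "card (?F \<times> ?F \<times> ?H) = card S"
    by (rule bij_betw_same_card)
  then show ?thesis
    by (simp add: card_cartesian_product power2_eq_square)
qed

text \<open>The mirror image: right multiplication by \<open>a\<close> identifies \<open>S g\<close>
  with \<open>S f\<close>, and \<open>b\<close> leads back.\<close>

lemma card_right_ideal_decompose:
  assumes "S \<subseteq> carrier R" and add: "\<And>x y. x \<in> S \<Longrightarrow> y \<in> S \<Longrightarrow> x \<oplus> y \<in> S"
    and mult: "\<And>r x. r \<in> carrier R \<Longrightarrow> x \<in> S \<Longrightarrow> x \<otimes> r \<in> S"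
  shows "card S = card ((\<lambda>s. s \<otimes> f) ` S) ^ 2 * card ((\<lambda>s. s \<otimes> h) ` S)"
proof -
  let ?F = "(\<lambda>s. s \<otimes> f) ` S" and ?H = "(\<lambda>s. s \<otimes> h) ` S"
  have sub: "x \<in> carrier R" if "x \<in> S" for x
    using assms that by blast
  have "bij_betw (\<lambda>(x, y, z). x \<oplus> y \<otimes> b \<oplus> z) (?F \<times> ?F \<times> ?H) S"
  proof (rule bij_betw_byWitness[where f' = "\<lambda>s. (s \<otimes> f, s \<otimes> a, s \<otimes> h)"])
    show "\<forall>s\<in>S. (case (s \<otimes> f, s \<otimes> a, s \<otimes> h) of (x, y, z) \<Rightarrow> x \<oplus> y \<otimes> b \<oplus> z) = s"
      using decompose_right sub by auto
    show "(\<lambda>s. (s \<otimes> f, s \<otimes> a, s \<otimes> h)) ` S \<subseteq> ?F \<times> ?F \<times> ?H"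
    proof -
      have "s \<otimes> a \<in> ?F" if "s \<in> S" for s
        using that sub mult by (intro image_eqI[of _ _ "s \<otimes> a"]) (simp_all add: peirce_mult m_assoc)
      then show ?thesis
        by auto
    qed
  qed (auto simp: sub add mult l_distr peirce_mult m_assoc)
  then have "card (?F \<times> ?F \<times> ?H) = card S"
    by (rule bij_betw_same_card)
  then show ?thesis
    by (simp add: card_cartesian_product power2_eq_square)
qed

text \<open>The left decomposition is applied to the whole ring, then the right decomposition to the
  right ideals \<open>f R\<close> and \<open>h R\<close>.\<close>

lemma order_eq_peirce:
  "order R = (card (peirce R f f) ^ 2 * card (peirce R f h)) ^ 2 *
    (card (peirce R h f) ^ 2 * card (peirce R h h))"
proof -
  have right: "card ((\<lambda>s. p \<otimes> s) ` carrier R) = card (peirce R p f) ^ 2 * card (peirce R p h)"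
    if p: "p \<in> carrier R" for p
  proof -
    have "card ((\<lambda>s. p \<otimes> s) ` carrier R) =
        card ((\<lambda>s. s \<otimes> f) ` (\<lambda>s. p \<otimes> s) ` carrier R) ^ 2 *
        card ((\<lambda>s. s \<otimes> h) ` (\<lambda>s. p \<otimes> s) ` carrier R)"
    proof (rule card_right_ideal_decompose)
      show "x \<oplus> y \<in> (\<lambda>s. p \<otimes> s) ` carrier R"
        if "x \<in> (\<lambda>s. p \<otimes> s) ` carrier R" "y \<in> (\<lambda>s. p \<otimes> s) ` carrier R" for x y
        using that p by (auto simp flip: r_distr)
      show "x \<otimes> r \<in> (\<lambda>s. p \<otimes> s) ` carrier R"
        if "r \<in> carrier R" "x \<in> (\<lambda>s. p \<otimes> s) ` carrier R" for r x
        using that p by (auto simp: m_assoc)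
    qed (use p in auto)
    then show ?thesis
      by (simp add: peirce_def image_image)
  qed
  have "order R = card ((\<lambda>s. f \<otimes> s) ` carrier R) ^ 2 * card ((\<lambda>s. h \<otimes> s) ` carrier R)"
    unfolding order_def by (rule card_left_ideal_decompose) auto
  then show ?thesis
    by (simp add: right)
qed

end

text \<open>A scalar action of the prime field that makes sense before characteristic 2 is known.
  Additivity in the scalar then needs \<open>x + x = 0\<close> for the element at hand.\<close>

definition bit_scale :: "('a, 'm) ring_scheme \<Rightarrow> bit \<Rightarrow> 'a \<Rightarrow> 'a" where
  "bit_scale R c x = (if c = 1 then x else \<zero>\<^bsub>R\<^esub>)"

context ring
begin

lemma bit_scale_closed [simp]: "x \<in> carrier R \<Longrightarrow> bit_scale R c x \<in> carrier R"
  by (simp add: bit_scale_def)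

lemma bit_scale_simps [simp]:
  "bit_scale R 0 x = \<zero>" "bit_scale R 1 x = x" "bit_scale R c \<zero> = \<zero>"
  by (simp_all add: bit_scale_def)

lemma bit_scale_add:
  "x \<in> carrier R \<Longrightarrow> x \<oplus> x = \<zero> \<Longrightarrow> bit_scale R (c + d) x = bit_scale R c x \<oplus> bit_scale R d x"
  by (cases c; cases d) simp_all

lemma bit_scale_mult:
  "x \<in> carrier R \<Longrightarrow> y \<in> carrier R \<Longrightarrow>
    bit_scale R c x \<otimes> bit_scale R d y = bit_scale R (c * d) (x \<otimes> y)"
  by (cases c; cases d) simp_all

lemma bit_scale_lmult:
  "x \<in> carrier R \<Longrightarrow> y \<in> carrier R \<Longrightarrow> y \<otimes> bit_scale R d x = bit_scale R d (y \<otimes> x)"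
  by (cases d) simp_all

lemma bit_scale_rmult:
  "x \<in> carrier R \<Longrightarrow> y \<in> carrier R \<Longrightarrow> bit_scale R d x \<otimes> y = bit_scale R d (x \<otimes> y)"
  by (cases d) simp_all

lemma bit_scale_inject: "x \<noteq> \<zero> \<Longrightarrow> bit_scale R c x = bit_scale R d x \<longleftrightarrow> c = d"
  by (cases c; cases d) auto

end

section \<open>Noncommutative rings of order eight\<close>

lemma UNIV_bit: "(UNIV :: bit set) = {0, 1}"
  by (auto intro: bit.exhaust)

lemma finite_UNIV_bit [simp]: "finite (UNIV :: bit set)"
  by (simp add: UNIV_bit)

lemma card_UNIV_bit [simp]: "card (UNIV :: bit set) = 2"
  by (simp add: UNIV_bit)

context ring
begin

definition commutator where "commutator u v = u \<otimes> v \<ominus> v \<otimes> u"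

lemma commutator_eq_zero_iff:
  "u \<in> carrier R \<Longrightarrow> v \<in> carrier R \<Longrightarrow> commutator u v = \<zero> \<longleftrightarrow> u \<otimes> v = v \<otimes> u"
  by (metis a_inv_closed commutator_def m_closed minus_eq minus_equality minus_minus r_neg)

lemma commutator_closed [simp]:
  "u \<in> carrier R \<Longrightarrow> v \<in> carrier R \<Longrightarrow> commutator u v \<in> carrier R"
  by (simp add: commutator_def)

lemma commutator_add:
  "\<lbrakk>u \<in> carrier R; v \<in> carrier R; w \<in> carrier R\<rbrakk> \<Longrightarrow>
    commutator (u \<oplus> v) w = commutator u w \<oplus> commutator v w"
  by (simp add: commutator_def minus_eq l_distr r_distr minus_add a_ac)

lemma commutator_bit_scale:
  "\<lbrakk>u \<in> carrier R; w \<in> carrier R\<rbrakk> \<Longrightarrow>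
    commutator (bit_scale R c u) w = bit_scale R c (commutator u w)"
  by (cases c) (simp_all add: commutator_def minus_eq)

definition bit_combination where
  "bit_combination x y = (\<lambda>(i, j, k). bit_scale R i \<one> \<oplus> bit_scale R j x \<oplus> bit_scale R k y)"

context
  fixes x y
  assumes fin: "finite (carrier R)" and closed [simp]: "x \<in> carrier R" "y \<in> carrier R"
    and noncomm: "x \<otimes> y \<noteq> y \<otimes> x"
begin

lemma commutator_bit_combination:
  "commutator (bit_combination x y (i, j, k)) x = bit_scale R k (commutator y x)"
  "commutator (bit_combination x y (i, j, k)) y = bit_scale R j (commutator x y)"
  by (simp_all add: bit_combination_def commutator_add commutator_bit_scale)
    (simp_all add: commutator_def minus_eq r_neg)

lemma commutator_nonzero: "commutator y x \<noteq> \<zero>" "commutator x y \<noteq> \<zero>"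
  using noncomm by (auto simp: commutator_eq_zero_iff)

lemma one_nonzero_noncommutative: "\<one> \<noteq> \<zero>"
  using noncomm by (metis closed l_null l_one)

lemma bit_combination_closed: "bit_combination x y t \<in> carrier R"
  by (simp add: bit_combination_def split: prod.split)

text \<open>The commutator with \<open>x\<close> reads off \<open>k\<close>, and the commutator with
  \<open>y\<close> reads off \<open>j\<close>; then \<open>i\<close> is determined as well. No
  assumption on the characteristic enters.\<close>

lemma inj_bit_combination: "inj (bit_combination x y)"
proof (rule injI, safe)
  fix i j k i' j' k'
  assume eq: "bit_combination x y (i, j, k) = bit_combination x y (i', j', k')"
  have k: "k = k'" and j: "j = j'"
    using arg_cong[OF eq, of "\<lambda>s. commutator s x"] arg_cong[OF eq, of "\<lambda>s. commutator s y"]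
    by (simp_all add: commutator_bit_combination bit_scale_inject commutator_nonzero)
  have "bit_scale R i \<one> = bit_scale R i' \<one>"
    using eq by (simp add: bit_combination_def k j)
  with k j show "i = i'" "j = j'" "k = k'"
    by (simp_all add: bit_scale_inject one_nonzero_noncommutative)
qed

lemma noncommutative_order_ge: "8 \<le> order R"
proof -
  have "card (range (bit_combination x y)) = 8"
    using inj_bit_combination
    by (simp add: card_image card_cartesian_product flip: UNIV_Times_UNIV)
  moreover have "range (bit_combination x y) \<subseteq> carrier R"
    using bit_combination_closed by auto
  ultimately show ?thesis
    unfolding order_def using card_mono[OF fin] by metis
qed

context
  assumes order8: "order R = 8"
begin

text \<open>The eight distinct combinations fill a ring with eight elements.\<close>

lemma order_8_bit_combination:
  assumes "v \<in> carrier R"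
  obtains i j k where "v = bit_scale R i \<one> \<oplus> bit_scale R j x \<oplus> bit_scale R k y"
proof -
  have "card (range (bit_combination x y)) = 8"
    using inj_bit_combination
    by (simp add: card_image card_cartesian_product flip: UNIV_Times_UNIV)
  then have "range (bit_combination x y) = carrier R"
    using bit_combination_closed order8 by (intro card_subset_eq fin) (auto simp: order_def)
  with assms that show thesis
    by (fastforce simp: bit_combination_def)
qed

lemma order_8_center:
  assumes "v \<in> carrier R" "v \<otimes> x = x \<otimes> v" "v \<otimes> y = y \<otimes> v"
  shows "v = \<zero> \<or> v = \<one>"
proof -
  obtain i j k where v: "v = bit_scale R i \<one> \<oplus> bit_scale R j x \<oplus> bit_scale R k y"
    using order_8_bit_combination assms(1) by blast
  then have "v = bit_combination x y (i, j, k)"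
    by (simp add: bit_combination_def)
  with assms have "bit_scale R k (commutator y x) = \<zero>" "bit_scale R j (commutator x y) = \<zero>"
    using commutator_eq_zero_iff[of v x] commutator_eq_zero_iff[of v y]
    by (simp_all add: commutator_bit_combination)
  then have "k = 0" "j = 0"
    using commutator_nonzero by (cases k; cases j; simp)+
  then show ?thesis
    by (cases i) (simp_all add: v)
qed

text \<open>The element \<open>1 + 1\<close> is central, hence 0 or 1, and \<open>1 + 1 = 1\<close>
  would give \<open>1 = 0\<close>.\<close>

lemma order_8_char_2: "v \<in> carrier R \<Longrightarrow> v \<oplus> v = \<zero>"
proof -
  have "\<one> \<oplus> \<one> = \<zero> \<or> \<one> \<oplus> \<one> = \<one>"
    by (rule order_8_center) (simp_all add: l_distr r_distr)
  then have "\<one> \<oplus> \<one> = \<zero>"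
    by (metis add.r_cancel_one one_closed)
  moreover assume "v \<in> carrier R"
  ultimately show ?thesis
    by (metis l_distr l_null l_one one_closed)
qed

end

end

text \<open>Here \<open>1, z, x\<close> is a basis over the prime field, with \<open>z = E\<^sub>1\<^sub>2\<close> and \<open>x = E\<^sub>2\<^sub>2\<close>.\<close>

lemma order_8_idempotent:
  assumes fin: "finite (carrier R)" and order8: "order R = 8"
    and [simp]: "x \<in> carrier R" "z \<in> carrier R"
    and xz: "x \<otimes> z = \<zero>" and zz: "z \<otimes> z = \<zero>" and zx: "z \<otimes> x \<noteq> \<zero>"
  shows "z \<otimes> x = z" "x \<otimes> x = x"
proof -
  have nc: "z \<otimes> x \<noteq> x \<otimes> z"
    by (simp add: xz zx)
  note span = order_8_bit_combination[OF fin \<open>z \<in> carrier R\<close> \<open>x \<in> carrier R\<close> nc order8]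
  note two = order_8_char_2[OF fin \<open>z \<in> carrier R\<close> \<open>x \<in> carrier R\<close> nc order8]
  have z0: "z \<noteq> \<zero>"
    using zx by auto
  obtain \<alpha> \<beta> \<gamma> where 1: "z \<otimes> x = bit_scale R \<alpha> \<one> \<oplus> bit_scale R \<beta> z \<oplus> bit_scale R \<gamma> x"
    by (rule span[of "z \<otimes> x"]) auto
  \<comment> \<open>Multiplying the expansion of \<open>z x\<close> by \<open>z\<close> leaves
    \<alpha>\<open>z\<close> + \<gamma>\<open>z x = 0\<close>. Equal coefficients lead to
    \<open>z x = z\<close>; unequal ones contradict \<open>z\<close> or \<open>z x\<close> being
    nonzero.\<close>
  have "z \<otimes> (z \<otimes> x) = \<zero>"
    by (simp add: zz flip: m_assoc)
  then have "bit_scale R \<alpha> z \<oplus> bit_scale R \<gamma> (z \<otimes> x) = \<zero>"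
    by (subst (asm) 1) (simp add: r_distr bit_scale_lmult zz)
  moreover have "z \<otimes> x = z" if "z \<oplus> z \<otimes> x = \<zero>"
    using minus_equality[of "z \<otimes> x" z] minus_equality[of z z] that two[of z] by (simp add: a_comm)
  ultimately show zxz: "z \<otimes> x = z"
    using 1 zx z0 by (cases \<gamma>; cases \<alpha>; cases \<beta>) simp_all
  obtain \<alpha> \<beta> \<gamma> where 2: "x \<otimes> x = bit_scale R \<alpha> \<one> \<oplus> bit_scale R \<beta> z \<oplus> bit_scale R \<gamma> x"
    by (rule span[of "x \<otimes> x"]) auto
  have "(x \<otimes> x) \<otimes> z = \<zero>"
    by (simp add: xz m_assoc)
  then have "bit_scale R \<alpha> z = \<zero>"
    by (subst (asm) 2) (simp add: l_distr bit_scale_rmult zz xz)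
  then have \<alpha>: "\<alpha> = 0"
    using z0 by (cases \<alpha>) auto
  have "z \<otimes> (x \<otimes> x) = z"
    by (simp add: zxz flip: m_assoc)
  then have "bit_scale R \<gamma> z = z"
    by (subst (asm) 2) (simp add: r_distr bit_scale_lmult zz zxz \<alpha>)
  then have \<gamma>: "\<gamma> = 1"
    using z0 by (cases \<gamma>) auto
  have xx: "x \<otimes> x = bit_scale R \<beta> z \<oplus> x"
    using 2 by (simp add: \<alpha> \<gamma>)
  \<comment> \<open>Comparing the two bracketings of \<open>x^3\<close> removes the last unknown
    coefficient, since \<open>x z = 0\<close> but \<open>z x = z\<close>.\<close>
  have "x \<otimes> (x \<otimes> x) = (x \<otimes> x) \<otimes> x"
    by (simp add: m_assoc)
  then have "bit_scale R \<beta> z \<oplus> x \<otimes> x = x \<otimes> x"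
    unfolding xx by (simp add: l_distr r_distr bit_scale_lmult bit_scale_rmult xz zxz)
  then have "bit_scale R \<beta> z = \<zero>"
    by simp
  with xx show "x \<otimes> x = x"
    by simp
qed

end

section \<open>Opposite rings and nonreflexive rings of order eight\<close>

lemma op_ring_simps [simp]:
  "carrier (op_ring R) = carrier R" "x \<otimes>\<^bsub>op_ring R\<^esub> y = y \<otimes>\<^bsub>R\<^esub> x"
  "\<one>\<^bsub>op_ring R\<^esub> = \<one>\<^bsub>R\<^esub>" "\<zero>\<^bsub>op_ring R\<^esub> = \<zero>\<^bsub>R\<^esub>" "x \<oplus>\<^bsub>op_ring R\<^esub> y = x \<oplus>\<^bsub>R\<^esub> y"
  "order (op_ring R) = order R" "op_ring (op_ring R) = R"
  by (simp_all add: op_ring_def order_def)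

context ring
begin

lemma ring_op: "ring (op_ring R)"
proof (rule ringI)
  show "abelian_group (op_ring R)"
    by (rule abelian_groupI) (auto simp: a_ac intro: l_neg a_inv_closed)
  show "monoid (op_ring R)"
    by (rule monoidI) (simp_all add: m_assoc)
qed (simp_all add: l_distr r_distr)

text \<open>A middle factor \<open>r\<close> with \<open>y r x\<close> nonzero can be absorbed into
  \<open>y\<close>, because \<open>x R (y r)\<close> still vanishes.\<close>

lemma nonreflexiveE:
  assumes "\<not> reflexive_ring R"
  obtains x y where "x \<in> carrier R" "y \<in> carrier R" "y \<otimes> x \<noteq> \<zero>"
    "\<And>r. r \<in> carrier R \<Longrightarrow> x \<otimes> r \<otimes> y = \<zero>"
proof -
  obtain x y r where xyr: "x \<in> carrier R" "y \<in> carrier R" "r \<in> carrier R" "y \<otimes> r \<otimes> x \<noteq> \<zero>"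
    "\<And>s. s \<in> carrier R \<Longrightarrow> x \<otimes> s \<otimes> y = \<zero>"
    using assms ring_axioms by (auto simp: reflexive_ring_def)
  then have "x \<otimes> s \<otimes> (y \<otimes> r) = \<zero>" if "s \<in> carrier R" for s
    using that by (simp flip: m_assoc)
  with xyr that[of x "y \<otimes> r"] show thesis
    by simp
qed

lemma nonreflexive_order_ge:
  assumes "finite (carrier R)" "\<not> reflexive_ring R"
  shows "8 \<le> order R"
proof -
  obtain x y where "x \<in> carrier R" "y \<in> carrier R" "y \<otimes> x \<noteq> \<zero>" "x \<otimes> \<one> \<otimes> y = \<zero>"
    using nonreflexiveE[OF assms(2)] by (metis one_closed)
  then show ?thesis
    by (intro noncommutative_order_ge[of x y] assms(1)) auto
qed

text \<open>Here \<open>z\<close> and \<open>q\<close> behave like \<open>E12\<close> and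
  \<open>E22\<close>. The element \<open>z = y x\<close> satisfies
  \<open>x z = z y = z z = 0\<close>. If also \<open>z x = y z = 0\<close>, it would be central,
  hence 0 or 1, which is absurd. Otherwise \<open>x\<close> is the idempotent \<open>q\<close>, or
  \<open>y\<close> is the complementary one.\<close>

lemma nonreflexive_order_8:
  assumes fin: "finite (carrier R)" and order8: "order R = 8" and nr: "\<not> reflexive_ring R"
  obtains z q where "z \<in> carrier R" "q \<in> carrier R" "z \<noteq> \<zero>" "z \<otimes> q = z" "q \<otimes> z = \<zero>"
    "q \<otimes> q = q" "\<And>v. v \<in> carrier R \<Longrightarrow> v \<oplus> v = \<zero>"
proof -
  obtain x y where [simp]: "x \<in> carrier R" "y \<in> carrier R" and yx: "y \<otimes> x \<noteq> \<zero>"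
    and xry: "\<And>r. r \<in> carrier R \<Longrightarrow> x \<otimes> r \<otimes> y = \<zero>"
    using nonreflexiveE[OF nr] by blast
  have xy: "x \<otimes> y = \<zero>"
    using xry[of "\<one>"] by simp
  then have nc: "x \<otimes> y \<noteq> y \<otimes> x"
    using yx by simp
  note two = order_8_char_2[OF fin \<open>x \<in> carrier R\<close> \<open>y \<in> carrier R\<close> nc order8]
  define z where "z = y \<otimes> x"
  have [simp]: "z \<in> carrier R"
    by (simp add: z_def)
  have z0: "z \<noteq> \<zero>"
    using yx by (simp add: z_def)
  have xz: "x \<otimes> z = \<zero>"
    by (simp add: z_def xy flip: m_assoc)
  have zy: "z \<otimes> y = \<zero>"
    by (simp add: z_def xy m_assoc)
  have zz: "z \<otimes> z = \<zero>"
    by (subst (1) z_def) (simp add: xz m_assoc)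
  consider "z \<otimes> x \<noteq> \<zero>" | "y \<otimes> z \<noteq> \<zero>" | "z \<otimes> x = \<zero>" "y \<otimes> z = \<zero>"
    by blast
  then show thesis
  proof cases
    case 1
    then show thesis
      using that[of z x] order_8_idempotent[OF fin order8 _ _ xz zz] z0 xz two by simp
  next
    case 2
    interpret op: ring "op_ring R"
      by (rule ring_op)
    have yz: "y \<otimes> z = z" and yy: "y \<otimes> y = y"
      using op.order_8_idempotent[of y z] fin order8 zy zz 2 by simp_all
    \<comment> \<open>The opposite ring makes \<open>y\<close> an idempotent fixing \<open>z\<close>
      from the left, so it plays \<open>E11\<close>, and \<open>1 - y\<close> plays
      \<open>E22\<close>.\<close>
    show thesis
      using that[of z "\<one> \<ominus> y"] z0 two
      by (simp add: minus_eq r_distr l_distr r_minus l_minus zy yz yy r_neg)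
  next
    case 3
    then have "z = \<zero> \<or> z = \<one>"
      by (intro order_8_center[OF fin \<open>x \<in> carrier R\<close> \<open>y \<in> carrier R\<close> nc order8])
        (simp_all add: xz zy)
    with z0 zz show thesis
      by auto
  qed
qed

end

section \<open>The three rings of order 128\<close>

text \<open>These rules would rewrite sums and products of bits to conditionals.\<close>

declare add_bit_eq_xor [simp del] mult_bit_eq_and [simp del]

lemma bit_add_self [simp]: "c + c = (0 :: bit)"
  by (cases c) simp_all

section \<open>Coordinates for matrices over the field with two elements\<close>

definition mat2 :: "bit \<Rightarrow> bit \<Rightarrow> bit \<Rightarrow> bit \<Rightarrow> bit mat" where
  "mat2 p q r s = mat 2 2 (\<lambda>(i, j). if i = 0 then if j = 0 then p else q else if j = 0 then r else s)"

lemma mat2_simps [simp]: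
  "mat2 p q r s \<in> carrier_mat 2 2" "dim_row (mat2 p q r s) = 2" "dim_col (mat2 p q r s) = 2"
  "mat2 p q r s $$ (0, 0) = p" "mat2 p q r s $$ (0, 1) = q"
  "mat2 p q r s $$ (1, 0) = r" "mat2 p q r s $$ (1, 1) = s"
  "mat2 p q r s $$ (0, Suc 0) = q" "mat2 p q r s $$ (Suc 0, 0) = r" "mat2 p q r s $$ (Suc 0, Suc 0) = s"
  by (simp_all add: mat2_def)

lemma mat2_entries:
  assumes "A \<in> carrier_mat 2 2"
  shows "mat2 (A $$ (0, 0)) (A $$ (0, 1)) (A $$ (1, 0)) (A $$ (1, 1)) = A"
  using assms by (intro eq_matI) (auto simp: mat2_def less_2_cases_iff)

lemma mat2_eq_iff [simp]:
  "mat2 p q r s = mat2 p' q' r' s' \<longleftrightarrow> p = p' \<and> q = q' \<and> r = r' \<and> s = s'"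
  by (metis mat2_simps(4-7))

lemma mat2_add [simp]:
  "mat2 p q r s + mat2 p' q' r' s' = mat2 (p + p') (q + q') (r + r') (s + s')"
  by (rule eq_matI) (auto simp: mat2_def less_2_cases_iff)

lemma mat2_mult [simp]:
  "mat2 p q r s * mat2 p' q' r' s' =
    mat2 (p * p' + q * r') (p * q' + q * s') (r * p' + s * r') (r * q' + s * s')"
  by (rule eq_matI) (auto simp: mat2_def less_2_cases_iff scalar_prod_def numeral_2_eq_2)

lemma mat2_smult [simp]: "c \<cdot>\<^sub>m mat2 p q r s = mat2 (c * p) (c * q) (c * r) (c * s)"
  by (rule eq_matI) (auto simp: mat2_def less_2_cases_iff)

lemma one_mat2: "1\<^sub>m 2 = mat2 1 0 0 1" and zero_mat2: "0\<^sub>m 2 2 = mat2 0 0 0 0"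
  by (rule eq_matI; auto simp: mat2_def less_2_cases_iff)+

lemma M2_F2_simps:
  "carrier M2_F2 = {x. \<exists>p q r s. x = mat2 p q r s}"
  "mult M2_F2 = (*)" "add M2_F2 = (+)" "one M2_F2 = mat2 1 0 0 1" "zero M2_F2 = mat2 0 0 0 0"
  by (auto simp: M2_F2_def ring_mat_simps one_mat2 zero_mat2) (metis mat2_entries)

lemma U2_F2_simps:
  "carrier U2_F2 = {x. \<exists>p q s. x = mat2 p q 0 s}"
  "mult U2_F2 = (*)" "add U2_F2 = (+)" "one U2_F2 = mat2 1 0 0 1" "zero U2_F2 = mat2 0 0 0 0"
proof -
  have "x \<in> carrier U2_F2 \<longleftrightarrow> (\<exists>p q s. x = mat2 p q 0 s)" for x
    using mat2_entries[of x]
    by (auto simp: U2_F2_def upper_triangular_def less_2_cases_iff) (metis)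
  then show "carrier U2_F2 = {x. \<exists>p q s. x = mat2 p q 0 s}"
    by blast
qed (simp_all add: U2_F2_def M2_F2_simps)

lemma V_F2_simps:
  "carrier V_F2 = {x. \<exists>u v. x = mat2 u 0 v 0}" "add V_F2 = (+)" "zero V_F2 = mat2 0 0 0 0"
proof -
  have "x \<in> carrier V_F2 \<longleftrightarrow> (\<exists>u v. x = mat2 u 0 v 0)" for x
    using mat2_entries[of x]
    by (auto simp: V_F2_def less_2_cases_iff) (metis)
  then show "carrier V_F2 = {x. \<exists>u v. x = mat2 u 0 v 0}"
    by blast
qed (simp_all add: V_F2_def M2_F2_simps)

lemma T_F2_simps:
  "carrier T_F2 = {x. \<exists>p q r s u v c. x = (mat2 p q r s, mat2 u 0 v 0, c)}"
  "(A, V, c) \<otimes>\<^bsub>T_F2\<^esub> (A', V', c') = (A * A', A * V' + c' \<cdot>\<^sub>m V, c * c')"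
  "(A, V, c) \<oplus>\<^bsub>T_F2\<^esub> (A', V', c') = (A + A', V + V', c + c')"
  "one T_F2 = (mat2 1 0 0 1, mat2 0 0 0 0, 1)" "zero T_F2 = (mat2 0 0 0 0, mat2 0 0 0 0, 0)"
  by (auto simp: T_F2_def formal_triangular_ring_def M2_F2_simps V_F2_simps F2_def)

lemma MU_simps:
  "carrier (RDirProd M2_F2 U2_F2) =
    {x. \<exists>p q r s u v w. x = (mat2 p q r s, mat2 u v 0 w)}"
  "(A, B) \<otimes>\<^bsub>RDirProd M2_F2 U2_F2\<^esub> (A', B') = (A * A', B * B')"
  "(A, B) \<oplus>\<^bsub>RDirProd M2_F2 U2_F2\<^esub> (A', B') = (A + A', B + B')"
  "one (RDirProd M2_F2 U2_F2) = (mat2 1 0 0 1, mat2 1 0 0 1)"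
  "zero (RDirProd M2_F2 U2_F2) = (mat2 0 0 0 0, mat2 0 0 0 0)"
  by (auto simp: RDirProd_def DirProd_def monoid.defs M2_F2_simps U2_F2_simps)

lemma ring_T_F2: "ring T_F2"
proof (rule ringI)
  show "abelian_group T_F2"
  proof (rule abelian_groupI)
    \<comment> \<open>In characteristic 2 every element is its own negative.\<close>
    show "\<exists>y\<in>carrier T_F2. y \<oplus>\<^bsub>T_F2\<^esub> x = \<zero>\<^bsub>T_F2\<^esub>" if "x \<in> carrier T_F2" for x
      using that by (intro bexI[of _ x]) (auto simp: T_F2_simps)
  qed (auto simp: T_F2_simps add_ac)
  show "Group.monoid T_F2"
    by (rule monoidI) (auto simp: T_F2_simps algebra_simps)
qed (auto simp: T_F2_simps algebra_simps)

lemma ring_M2_F2: "ring M2_F2"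
proof (rule ringI)
  show "abelian_group M2_F2"
  proof (rule abelian_groupI)
    show "\<exists>y\<in>carrier M2_F2. y \<oplus>\<^bsub>M2_F2\<^esub> x = \<zero>\<^bsub>M2_F2\<^esub>" if "x \<in> carrier M2_F2" for x
      using that by (intro bexI[of _ x]) (auto simp: M2_F2_simps)
  qed (auto simp: M2_F2_simps add_ac)
  show "Group.monoid M2_F2"
    by (rule monoidI) (auto simp: M2_F2_simps algebra_simps)
qed (auto simp: M2_F2_simps algebra_simps)

lemma ring_U2_F2: "ring U2_F2"
proof (rule ringI)
  show "abelian_group U2_F2"
  proof (rule abelian_groupI)
    show "\<exists>y\<in>carrier U2_F2. y \<oplus>\<^bsub>U2_F2\<^esub> x = \<zero>\<^bsub>U2_F2\<^esub>" if "x \<in> carrier U2_F2" for x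
      using that by (intro bexI[of _ x]) (auto simp: U2_F2_simps)
  qed (auto simp: U2_F2_simps add_ac)
  show "Group.monoid U2_F2"
    by (rule monoidI) (auto simp: U2_F2_simps algebra_simps)
qed (auto simp: U2_F2_simps algebra_simps)

lemma ring_MU: "ring (RDirProd M2_F2 U2_F2)"
  by (intro RDirProd_ring ring_M2_F2 ring_U2_F2)

text \<open>Seven free bits: four for the matrix, two for the column vector, one for the
  scalar.\<close>

lemma order_T_F2: "order T_F2 = 128"
proof -
  let ?f = "\<lambda>(p, q, r, s, u, v, c :: bit). (mat2 p q r s, mat2 u 0 v 0, c)"
  have "carrier T_F2 = range ?f"
    by (auto simp: T_F2_simps image_iff)
  moreover have "inj ?f"
    by (auto simp: inj_def)
  moreover from this
  have "card (range ?f) = card (UNIV :: (bit \<times> bit \<times> bit \<times> bit \<times> bit \<times> bit \<times> bit) set)"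
    by (rule card_image)
  ultimately have "order T_F2 = card (UNIV :: (bit \<times> bit \<times> bit \<times> bit \<times> bit \<times> bit \<times> bit) set)"
    by (simp only: order_def)
  then show ?thesis
    by (simp add: card_cartesian_product flip: UNIV_Times_UNIV)
qed

lemma order_MU: "order (RDirProd M2_F2 U2_F2) = 128"
proof -
  let ?f = "\<lambda>(p, q, r, s, u, v, w). (mat2 p q r s, mat2 u v 0 w)"
  have "carrier (RDirProd M2_F2 U2_F2) = range ?f"
    by (auto simp: MU_simps image_iff)
  moreover have "inj ?f"
    by (auto simp: inj_def)
  moreover from this
  have "card (range ?f) = card (UNIV :: (bit \<times> bit \<times> bit \<times> bit \<times> bit \<times> bit \<times> bit) set)"
    by (rule card_image)
  ultimately have "order (RDirProd M2_F2 U2_F2) =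
    card (UNIV :: (bit \<times> bit \<times> bit \<times> bit \<times> bit \<times> bit \<times> bit) set)"
    by (simp only: order_def)
  then show ?thesis
    by (simp add: card_cartesian_product flip: UNIV_Times_UNIV)
qed

section \<open>The three rings are neither NI nor reflexive\<close>

context ring
begin

text \<open>If the nilpotents formed an ideal, it would contain \<open>a\<close> and hence the
  nonzero idempotent \<open>b a\<close>. In the examples \<open>a\<close> and \<open>b\<close> are
  \<open>E21\<close> and \<open>E12\<close>.\<close>

lemma not_NI_ringI:
  assumes "a \<in> carrier R" "b \<in> carrier R" "a \<otimes> a = \<zero>"
    and "b \<otimes> a \<otimes> (b \<otimes> a) = b \<otimes> a" "b \<otimes> a \<noteq> \<zero>"
  shows "\<not> NI_ring R"
proof
  assume "NI_ring R"
  moreover have "a [^] (2 :: nat) = \<zero>"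
    using assms(1,3) by (simp add: numeral_2_eq_2)
  then have "a \<in> nilpotents R"
    using assms(1) zero_less_numeral unfolding nilpotents_def by blast
  ultimately have "b \<otimes> a \<in> nilpotents R"
    using assms(2) by (simp add: NI_ring_def ideal.I_l_closed)
  then obtain n :: nat where n: "n > 0" "(b \<otimes> a) [^] n = \<zero>"
    by (auto simp: nilpotents_def)
  have "(b \<otimes> a) [^] Suc n = b \<otimes> a" for n :: nat
    by (induction n) (use assms in simp_all)
  with n assms(5) show False
    by (metis Suc_pred)
qed

end

text \<open>Reversing products turns \<open>x R y = 0\<close> into \<open>y R x = 0\<close> for the
  opposite multiplication, so the condition is symmetric. The converse follows because taking
  opposites twice gives \<open>R\<close> back.\<close>

lemma reflexive_op_ringD:
  assumes "ring R" "reflexive_ring (op_ring R)"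
  shows "reflexive_ring R"
proof -
  interpret ring R
    by fact
  show ?thesis
    unfolding reflexive_ring_def
  proof (intro conjI ballI impI assms(1))
    fix x y r
    assume xy: "x \<in> carrier R" "y \<in> carrier R" "r \<in> carrier R"
      and z: "\<forall>r\<in>carrier R. x \<otimes>\<^bsub>R\<^esub> r \<otimes>\<^bsub>R\<^esub> y = \<zero>\<^bsub>R\<^esub>"
    then have "\<forall>r\<in>carrier R. x \<otimes>\<^bsub>R\<^esub> (r \<otimes>\<^bsub>R\<^esub> y) = \<zero>\<^bsub>R\<^esub>"
      by (simp add: m_assoc)
    then have "y \<otimes>\<^bsub>R\<^esub> (r \<otimes>\<^bsub>R\<^esub> x) = \<zero>\<^bsub>R\<^esub>"
      using assms(2) xy unfolding reflexive_ring_def by simp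
    then show "y \<otimes>\<^bsub>R\<^esub> r \<otimes>\<^bsub>R\<^esub> x = \<zero>\<^bsub>R\<^esub>"
      using xy by (simp add: m_assoc)
  qed
qed

lemma reflexive_op_ring_iff: "ring R \<Longrightarrow> reflexive_ring (op_ring R) \<longleftrightarrow> reflexive_ring R"
  using reflexive_op_ringD[of R] reflexive_op_ringD[of "op_ring R"] ring.ring_op[of R] by auto

lemma NI_op_ringD:
  assumes "ring R" "NI_ring R"
  shows "NI_ring (op_ring R)"
proof -
  interpret ring R
    by fact
  interpret op: ring "op_ring R"
    by (rule ring_op)
  have pow: "x [^]\<^bsub>op_ring R\<^esub> n = x [^]\<^bsub>R\<^esub> n" if "x \<in> carrier R" for x and n :: nat
  proof (induction n)
    case (Suc n)
    then show ?case
      using that by simp (metis nat_pow_Suc nat_pow_Suc2)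
  qed simp
  then have nil: "nilpotents (op_ring R) = nilpotents R"
    by (auto simp: nilpotents_def)
  interpret I: ideal "nilpotents R" R
    using assms(2) by (simp add: NI_ring_def)
  have "ideal (nilpotents (op_ring R)) (op_ring R)"
    unfolding nil
  proof (rule idealI[OF op.ring_axioms])
    show "subgroup (nilpotents R) (add_monoid (op_ring R))"
      using I.additive_subgroup_axioms by (simp add: additive_subgroup_def op_ring_def)
  qed (simp_all add: I.I_l_closed I.I_r_closed)
  then show ?thesis
    by (simp add: NI_ring_def op.ring_axioms)
qed

lemma NI_op_ring_iff: "ring R \<Longrightarrow> NI_ring (op_ring R) \<longleftrightarrow> NI_ring R"
  using NI_op_ringD[of R] NI_op_ringD[of "op_ring R"] ring.ring_op[of R] by auto

lemma not_NI_T_F2: "\<not> NI_ring T_F2"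
  by (rule ring.not_NI_ringI[OF ring_T_F2, of "(mat2 0 0 1 0, mat2 0 0 0 0, 0)"
        "(mat2 0 1 0 0, mat2 0 0 0 0, 0)"]) (simp_all add: T_F2_simps)

lemma not_reflexive_ringI:
  assumes "x \<in> carrier R" "y \<in> carrier R" "r \<in> carrier R"
    and "\<And>s. s \<in> carrier R \<Longrightarrow> x \<otimes>\<^bsub>R\<^esub> s \<otimes>\<^bsub>R\<^esub> y = \<zero>\<^bsub>R\<^esub>"
    and "y \<otimes>\<^bsub>R\<^esub> r \<otimes>\<^bsub>R\<^esub> x \<noteq> \<zero>\<^bsub>R\<^esub>"
  shows "\<not> reflexive_ring R"
  using assms unfolding reflexive_ring_def by blast

text \<open>The lower left block is zero, so \<open>(0, 0, 1)\<close> times anything times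
  \<open>(E11, 0, 0)\<close> vanishes, while the reverse order reaches the bimodule.\<close>

lemma not_reflexive_T_F2: "\<not> reflexive_ring T_F2"
proof (rule not_reflexive_ringI)
  show "(mat2 0 0 0 0, mat2 0 0 0 0, 1) \<otimes>\<^bsub>T_F2\<^esub> s \<otimes>\<^bsub>T_F2\<^esub> (mat2 1 0 0 0, mat2 0 0 0 0, 0) =
    \<zero>\<^bsub>T_F2\<^esub>" if "s \<in> carrier T_F2" for s
    using that by (auto simp: T_F2_simps)
  show "(mat2 1 0 0 0, mat2 0 0 0 0, 0) \<otimes>\<^bsub>T_F2\<^esub> (mat2 0 0 0 0, mat2 1 0 0 0, 0) \<otimes>\<^bsub>T_F2\<^esub>
    (mat2 0 0 0 0, mat2 0 0 0 0, 1) \<noteq> \<zero>\<^bsub>T_F2\<^esub>"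
    by (simp add: T_F2_simps)
qed (simp_all add: T_F2_simps)

lemma not_NI_MU: "\<not> NI_ring (RDirProd M2_F2 U2_F2)"
  by (rule ring.not_NI_ringI[OF ring_MU, of "(mat2 0 0 1 0, mat2 0 0 0 0)"
        "(mat2 0 1 0 0, mat2 0 0 0 0)"]) (simp_all add: MU_simps)

lemma not_reflexive_MU: "\<not> reflexive_ring (RDirProd M2_F2 U2_F2)"
proof (rule not_reflexive_ringI)
  let ?R = "RDirProd M2_F2 U2_F2"
  show "(mat2 0 0 0 0, mat2 0 0 0 1) \<otimes>\<^bsub>?R\<^esub> s \<otimes>\<^bsub>?R\<^esub> (mat2 0 0 0 0, mat2 1 0 0 0) = \<zero>\<^bsub>?R\<^esub>"
    if "s \<in> carrier ?R" for s
    using that by (auto simp: MU_simps)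
  show "(mat2 0 0 0 0, mat2 1 0 0 0) \<otimes>\<^bsub>?R\<^esub> (mat2 0 0 0 0, mat2 0 1 0 0) \<otimes>\<^bsub>?R\<^esub>
    (mat2 0 0 0 0, mat2 0 0 0 1) \<noteq> \<zero>\<^bsub>?R\<^esub>"
    by (simp add: MU_simps)
qed (simp_all add: MU_simps)

text \<open>Two isomorphism invariants: the existence of a right ideal \<open>x R = {0, x}\<close> of order two, which
  separates \<^const>\<open>T_F2\<close> from its opposite, and of a nontrivial central idempotent.\<close>

definition has_right_ideal_of_order_2 :: "('a, 'm) ring_scheme \<Rightarrow> bool" where
  "has_right_ideal_of_order_2 R \<longleftrightarrow>
    (\<exists>x\<in>carrier R. x \<noteq> \<zero>\<^bsub>R\<^esub> \<and> (\<forall>r\<in>carrier R. x \<otimes>\<^bsub>R\<^esub> r = \<zero>\<^bsub>R\<^esub> \<or> x \<otimes>\<^bsub>R\<^esub> r = x))"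

definition has_central_idempotent :: "('a, 'm) ring_scheme \<Rightarrow> bool" where
  "has_central_idempotent R \<longleftrightarrow>
    (\<exists>x\<in>carrier R. x \<noteq> \<zero>\<^bsub>R\<^esub> \<and> x \<noteq> \<one>\<^bsub>R\<^esub> \<and> x \<otimes>\<^bsub>R\<^esub> x = x \<and>
      (\<forall>r\<in>carrier R. x \<otimes>\<^bsub>R\<^esub> r = r \<otimes>\<^bsub>R\<^esub> x))"

lemma ring_iso_zero:
  assumes "ring R" "ring S" "\<phi> \<in> ring_iso R S"
  shows "\<phi> \<zero>\<^bsub>R\<^esub> = \<zero>\<^bsub>S\<^esub>"
  using assms by (simp add: ring_iso_def ring_hom_zero)

lemma has_right_ideal_of_order_2_iso:
  assumes "ring R" "ring S" "R \<simeq> S" "has_right_ideal_of_order_2 R"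
  shows "has_right_ideal_of_order_2 S"
proof -
  interpret R: ring R
    by fact
  obtain \<phi> where \<phi>: "\<phi> \<in> ring_iso R S"
    using assms(3) by (auto simp: is_ring_iso_def)
  note iso = ring_iso_memE[OF \<phi>] ring_iso_zero[OF assms(1,2) \<phi>]
  obtain x where x: "x \<in> carrier R" "x \<noteq> \<zero>\<^bsub>R\<^esub>"
    "\<And>r. r \<in> carrier R \<Longrightarrow> x \<otimes>\<^bsub>R\<^esub> r = \<zero>\<^bsub>R\<^esub> \<or> x \<otimes>\<^bsub>R\<^esub> r = x"
    using assms(4) by (auto simp: has_right_ideal_of_order_2_def)
  have "\<phi> x \<otimes>\<^bsub>S\<^esub> s = \<zero>\<^bsub>S\<^esub> \<or> \<phi> x \<otimes>\<^bsub>S\<^esub> s = \<phi> x" if s: "s \<in> carrier S" for s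
  proof -
    obtain r where "r \<in> carrier R" "s = \<phi> r"
      using iso(5) s by (auto simp: bij_betw_def)
    then show ?thesis
      using x(1) x(3)[of r] iso(2)[of x r] iso(6) by auto
  qed
  moreover have "\<phi> x \<noteq> \<zero>\<^bsub>S\<^esub>"
    using x(1,2) iso(5,6) by (metis R.zero_closed bij_betw_def inj_on_eq_iff)
  ultimately show ?thesis
    using x(1) iso(1) by (auto simp: has_right_ideal_of_order_2_def)
qed

lemma has_central_idempotent_iso:
  assumes "ring R" "ring S" "R \<simeq> S" "has_central_idempotent R"
  shows "has_central_idempotent S"
proof -
  interpret R: ring R
    by fact
  obtain \<phi> where \<phi>: "\<phi> \<in> ring_iso R S"
    using assms(3) by (auto simp: is_ring_iso_def)
  note iso = ring_iso_memE[OF \<phi>] ring_iso_zero[OF assms(1,2) \<phi>]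
  obtain x where x: "x \<in> carrier R" "x \<noteq> \<zero>\<^bsub>R\<^esub>" "x \<noteq> \<one>\<^bsub>R\<^esub>" "x \<otimes>\<^bsub>R\<^esub> x = x"
    "\<And>r. r \<in> carrier R \<Longrightarrow> x \<otimes>\<^bsub>R\<^esub> r = r \<otimes>\<^bsub>R\<^esub> x"
    using assms(4) unfolding has_central_idempotent_def by blast
  have "\<phi> x \<otimes>\<^bsub>S\<^esub> s = s \<otimes>\<^bsub>S\<^esub> \<phi> x" if s: "s \<in> carrier S" for s
  proof -
    obtain r where "r \<in> carrier R" "s = \<phi> r"
      using iso(5) s by (auto simp: bij_betw_def)
    then show ?thesis
      using x(1,5) iso(2) by metis
  qed
  moreover have "\<phi> x \<noteq> \<zero>\<^bsub>S\<^esub>" "\<phi> x \<noteq> \<one>\<^bsub>S\<^esub>"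
    using x(1-3) iso(4-6) by (metis R.zero_closed R.one_closed bij_betw_def inj_on_eq_iff)+
  moreover have "\<phi> x \<otimes>\<^bsub>S\<^esub> \<phi> x = \<phi> x"
    using iso(2)[of x x] x(1,4) by simp
  ultimately show ?thesis
    using x(1) iso(1) unfolding has_central_idempotent_def by blast
qed

text \<open>The bottom row of the triangular matrices has a single free entry, so
  \<open>(0, 0, 1)\<close> generates a right ideal of two elements.\<close>

lemma right_ideal_T_F2: "has_right_ideal_of_order_2 T_F2"
proof -
  have "x \<otimes>\<^bsub>T_F2\<^esub> r = \<zero>\<^bsub>T_F2\<^esub> \<or> x \<otimes>\<^bsub>T_F2\<^esub> r = x"
    if "x = (mat2 0 0 0 0, mat2 0 0 0 0, 1)" "r \<in> carrier T_F2" for x r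
    using that by (auto simp: T_F2_simps)
  then show ?thesis
    unfolding has_right_ideal_of_order_2_def
    by (intro bexI[of _ "(mat2 0 0 0 0, mat2 0 0 0 0, 1)"]) (auto simp: T_F2_simps)
qed

lemma right_ideal_op_T_F2: "\<not> has_right_ideal_of_order_2 (op_ring T_F2)"
proof
  assume "has_right_ideal_of_order_2 (op_ring T_F2)"
  then obtain x where x: "x \<in> carrier T_F2" "x \<noteq> \<zero>\<^bsub>T_F2\<^esub>"
    "\<And>r. r \<in> carrier T_F2 \<Longrightarrow> r \<otimes>\<^bsub>T_F2\<^esub> x = \<zero>\<^bsub>T_F2\<^esub> \<or> r \<otimes>\<^bsub>T_F2\<^esub> x = x"
    by (auto simp: has_right_ideal_of_order_2_def)
  obtain p q r s u v c where [simp]: "x = (mat2 p q r s, mat2 u 0 v 0, c)"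
    using x(1) by (auto simp: T_F2_simps)
  have *: "(A, V, d) \<otimes>\<^bsub>T_F2\<^esub> x = \<zero>\<^bsub>T_F2\<^esub> \<or> (A, V, d) \<otimes>\<^bsub>T_F2\<^esub> x = x"
    if "(A, V, d) \<in> carrier T_F2" for A V d
    using x(3) that by blast
  \<comment> \<open>Multiplying \<open>x\<close> by bimodule elements forces \<open>c = 0\<close>.
    Then \<open>E12\<close> and \<open>E21\<close> move one row of \<open>x\<close> into the other;
    neither product can equal the nonzero \<open>x\<close>, so both vanish and
    \<open>x = 0\<close>.\<close>
  show False
    using *[of "mat2 0 0 0 0" "mat2 1 0 0 0" 0] *[of "mat2 0 0 0 0" "mat2 0 0 1 0" 0]
      *[of "mat2 0 1 0 0" "mat2 0 0 0 0" 0] *[of "mat2 0 0 1 0" "mat2 0 0 0 0" 0]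
      *[of "mat2 0 1 1 0" "mat2 0 0 0 0" 0] x(2)
    by (auto simp: T_F2_simps)
qed

lemma central_idempotent_MU: "has_central_idempotent (RDirProd M2_F2 U2_F2)"
  unfolding has_central_idempotent_def
  by (intro bexI[of _ "(mat2 1 0 0 1, mat2 0 0 0 0)"]) (auto simp: MU_simps)

lemma central_idempotent_T_F2: "\<not> has_central_idempotent T_F2"
proof
  assume "has_central_idempotent T_F2"
  then obtain x where x: "x \<in> carrier T_F2" "x \<noteq> \<zero>\<^bsub>T_F2\<^esub>" "x \<noteq> \<one>\<^bsub>T_F2\<^esub>"
    "\<And>r. r \<in> carrier T_F2 \<Longrightarrow> x \<otimes>\<^bsub>T_F2\<^esub> r = r \<otimes>\<^bsub>T_F2\<^esub> x"
    unfolding has_central_idempotent_def by blast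
  obtain p q r s u v c where [simp]: "x = (mat2 p q r s, mat2 u 0 v 0, c)"
    using x(1) by (auto simp: T_F2_simps)
  have *: "(A, V, d) \<otimes>\<^bsub>T_F2\<^esub> x = x \<otimes>\<^bsub>T_F2\<^esub> (A, V, d)"
    if "(A, V, d) \<in> carrier T_F2" for A V d
    using x(4)[OF that] by simp
  \<comment> \<open>Commuting with the two basis vectors of the bimodule makes the matrix part of
    \<open>x\<close> the scalar \<open>c\<close>; commuting with \<open>(0, 0, 1)\<close> kills the
    bimodule part. Only zero and one remain.\<close>
  show False
    using *[of "mat2 0 0 0 0" "mat2 1 0 0 0" 0] *[of "mat2 0 0 0 0" "mat2 0 0 1 0" 0]
      *[of "mat2 0 0 0 0" "mat2 0 0 0 0" 1] x(2,3)
    by (cases c) (auto simp: T_F2_simps)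
qed

lemma central_idempotent_op_ring: "has_central_idempotent (op_ring R) \<longleftrightarrow> has_central_idempotent R"
  by (simp add: has_central_idempotent_def eq_commute)

lemma pairwise_not_isomorphic:
  "\<not> T_F2 \<simeq> op_ring T_F2"
  "\<not> T_F2 \<simeq> RDirProd M2_F2 U2_F2"
  "\<not> op_ring T_F2 \<simeq> RDirProd M2_F2 U2_F2"
proof -
  note rings = ring_T_F2 ring.ring_op[OF ring_T_F2] ring_MU
  show "\<not> T_F2 \<simeq> op_ring T_F2"
    using has_right_ideal_of_order_2_iso right_ideal_T_F2 right_ideal_op_T_F2 rings by blast
  have sym: "\<not> R \<simeq> RDirProd M2_F2 U2_F2" if "ring R" "\<not> has_central_idempotent R"
    for R :: "(bit mat \<times> bit mat \<times> bit) ring"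
    using has_central_idempotent_iso[OF ring_MU that(1)] central_idempotent_MU that
      ring_iso_sym[OF that(1)] by blast
  show "\<not> T_F2 \<simeq> RDirProd M2_F2 U2_F2" "\<not> op_ring T_F2 \<simeq> RDirProd M2_F2 U2_F2"
    by (intro sym rings; simp add: central_idempotent_op_ring central_idempotent_T_F2)+
qed

section \<open>Classification\<close>

definition corner_ring :: "('a, 'm) ring_scheme \<Rightarrow> 'a \<Rightarrow> ('a, 'm) ring_scheme" where
  "corner_ring R p = R\<lparr>carrier := peirce R p p, one := p\<rparr>"

lemma corner_ring_simps [simp]:
  "carrier (corner_ring R p) = peirce R p p" "x \<otimes>\<^bsub>corner_ring R p\<^esub> y = x \<otimes>\<^bsub>R\<^esub> y"
  "\<one>\<^bsub>corner_ring R p\<^esub> = p" "\<zero>\<^bsub>corner_ring R p\<^esub> = \<zero>\<^bsub>R\<^esub>" "x \<oplus>\<^bsub>corner_ring R p\<^esub> y = x \<oplus>\<^bsub>R\<^esub> y"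
  by (simp_all add: corner_ring_def)

lemma bij_betw_inj_card:
  assumes "inj_on \<phi> S" "\<phi> ` S \<subseteq> S'" "finite S'" "card S = card S'"
  shows "bij_betw \<phi> S S'"
  using assms by (simp add: bij_betw_def card_image card_subset_eq)

context ring
begin

context
  fixes p q
  assumes closed [simp]: "p \<in> carrier R" "q \<in> carrier R"
    and idem: "p \<otimes> p = p" "q \<otimes> q = q"
begin

lemma mem_peirce_iff: "x \<in> peirce R p q \<longleftrightarrow> x \<in> carrier R \<and> p \<otimes> x = x \<and> x \<otimes> q = x"
proof
  assume "x \<in> peirce R p q"
  then obtain s where s: "s \<in> carrier R" "x = p \<otimes> s \<otimes> q"
    by (auto simp: peirce_def)
  have "p \<otimes> (p \<otimes> s \<otimes> q) = (p \<otimes> p) \<otimes> s \<otimes> q"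
    using s by (simp only: m_assoc closed m_closed)
  moreover have "p \<otimes> s \<otimes> q \<otimes> q = p \<otimes> s \<otimes> (q \<otimes> q)"
    using s by (simp only: m_assoc closed m_closed)
  ultimately show "x \<in> carrier R \<and> p \<otimes> x = x \<and> x \<otimes> q = x"
    using s by (simp add: idem)
next
  assume x: "x \<in> carrier R \<and> p \<otimes> x = x \<and> x \<otimes> q = x"
  then have "x = p \<otimes> x \<otimes> q"
    by simp
  with x show "x \<in> peirce R p q"
    unfolding peirce_def by blast
qed

lemma zero_mem_peirce [simp]: "\<zero> \<in> peirce R p q"
  by (simp add: mem_peirce_iff)

lemma add_mem_peirce: "x \<in> peirce R p q \<Longrightarrow> y \<in> peirce R p q \<Longrightarrow> x \<oplus> y \<in> peirce R p q"
  by (simp add: mem_peirce_iff l_distr r_distr)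

lemma finite_peirce: "finite (carrier R) \<Longrightarrow> finite (peirce R p q)"
  by (simp add: peirce_def)

lemma card_peirce_ge_2:
  assumes "finite (carrier R)" "x \<in> peirce R p q" "x \<noteq> \<zero>"
  shows "2 \<le> card (peirce R p q)"
proof -
  have "card {\<zero>, x} \<le> card (peirce R p q)"
    using assms by (intro card_mono finite_peirce) auto
  with assms(3) show ?thesis
    by simp
qed

lemma card_peirce_ge_1:
  assumes "finite (carrier R)"
  shows "1 \<le> card (peirce R p q)"
  using assms zero_mem_peirce finite_peirce by (metis One_nat_def Suc_leI card_gt_0_iff empty_iff)

text \<open>The component is \<open>{0, x}\<close> and closed under addition, and
  \<open>x + x = x\<close> would give \<open>x = 0\<close>.\<close>

lemma card_peirce_2_char_2:
  assumes fin: "finite (carrier R)" and card2: "card (peirce R p q) = 2"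
    and x: "x \<in> peirce R p q" "x \<noteq> \<zero>"
  shows "x \<oplus> x = \<zero>"
proof -
  have xc: "x \<in> carrier R"
    using x by (simp add: mem_peirce_iff)
  have "peirce R p q = {\<zero>, x}"
    using x card2 by (intro card_subset_eq[symmetric] finite_peirce fin) auto
  then have "x \<oplus> x = \<zero> \<or> x \<oplus> x = x"
    using add_mem_peirce[OF x(1) x(1)] by blast
  with x(2) xc show ?thesis
    by auto
qed

end

lemma ring_corner:
  assumes [simp]: "p \<in> carrier R" and idem: "p \<otimes> p = p"
  shows "ring (corner_ring R p)"
proof (rule ringI)
  note mem = mem_peirce_iff[OF assms(1) assms(1) idem idem]
  show "abelian_group (corner_ring R p)"
  proof (rule abelian_groupI)
    show "\<exists>y\<in>carrier (corner_ring R p). y \<oplus>\<^bsub>corner_ring R p\<^esub> x = \<zero>\<^bsub>corner_ring R p\<^esub>"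
      if "x \<in> carrier (corner_ring R p)" for x
      using that by (intro bexI[of _ "\<ominus> x"]) (auto simp: mem l_neg r_minus l_minus)
  qed (auto simp: mem a_ac l_distr r_distr)
  show "Group.monoid (corner_ring R p)"
  proof (rule monoidI)
    show "x \<otimes>\<^bsub>corner_ring R p\<^esub> y \<in> carrier (corner_ring R p)"
      if "x \<in> carrier (corner_ring R p)" "y \<in> carrier (corner_ring R p)" for x y
      using that by (simp add: mem m_assoc) (simp add: mem flip: m_assoc)
  qed (auto simp: mem m_assoc idem)
qed (auto simp: mem_peirce_iff[OF assms(1) assms(1) idem idem] l_distr r_distr)

end

text \<open>The product is monotone and equals 128 at \<open>A = W = B = 2\<close>,
  \<open>U = 1\<close>. Raising \<open>A\<close>, \<open>W\<close> or \<open>B\<close> to 3 gives at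
  least 648, 288 or 192.\<close>

lemma peirce_card_bound:
  fixes A W U B :: nat
  assumes "2 \<le> A" "2 \<le> W" "1 \<le> U" "2 \<le> B" "(A ^ 2 * W) ^ 2 * (U ^ 2 * B) \<le> 128"
  shows "A = 2" "W = 2" "B = 2" "(A ^ 2 * W) ^ 2 * (U ^ 2 * B) = 128"
proof -
  have AW: "a\<^sup>2 * w \<le> A\<^sup>2 * W" if "a \<le> A" "w \<le> W" for a w
    using that by (intro mult_mono power_mono) auto
  have lower: "(a\<^sup>2 * w)\<^sup>2 * b \<le> 128" if "a \<le> A" "w \<le> W" "b \<le> B" for a w b
  proof -
    have "(a\<^sup>2 * w)\<^sup>2 * (1\<^sup>2 * b) \<le> (A\<^sup>2 * W)\<^sup>2 * (U\<^sup>2 * B)"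
      using that assms(3) AW by (intro mult_mono power_mono) auto
    with assms(5) show ?thesis
      by simp
  qed
  have "\<not> 3 \<le> A" "\<not> 3 \<le> W" "\<not> 3 \<le> B"
    using lower[of 3 2 2] lower[of 2 3 2] lower[of 2 2 3] assms(1,2,4) by auto
  with assms(1,2,4) show "A = 2" "W = 2" "B = 2"
    by linarith+
  have "(2\<^sup>2 * 2)\<^sup>2 * (1\<^sup>2 * 2) \<le> (A\<^sup>2 * W)\<^sup>2 * (U\<^sup>2 * B)"
    using assms AW by (intro mult_mono power_mono) auto
  with assms(5) show "(A ^ 2 * W) ^ 2 * (U ^ 2 * B) = 128"
    by simp
qed

section \<open>A nonzero off-diagonal component: the triangular ring\<close>

context matrix_units
begin

lemmas mem_peirce_ff = mem_peirce_iff[OF units_closed(1) units_closed(1) ff ff]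
lemmas mem_peirce_fh = mem_peirce_iff[OF units_closed(1) gh_closed(2) ff hh]
lemmas mem_peirce_hh = mem_peirce_iff[OF gh_closed(2) gh_closed(2) hh hh]

text \<open>The basis of matrix units, two column vectors and the scalar unit goes to
  \<open>f, b, a, g\<close>, then \<open>w, a w\<close>, then \<open>h\<close>. As \<open>a\<close>
  acts like \<open>E21\<close>, it carries the first column vector to the second.\<close>

definition T_map where
  "T_map w = (\<lambda>(A, V, c).
    bit_scale R (A $$ (0, 0)) f \<oplus> bit_scale R (A $$ (0, 1)) b \<oplus>
    bit_scale R (A $$ (1, 0)) a \<oplus> bit_scale R (A $$ (1, 1)) g \<oplus>
    bit_scale R (V $$ (0, 0)) w \<oplus> bit_scale R (V $$ (1, 0)) (a \<otimes> w) \<oplus> bit_scale R c h)"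

lemma T_map_mat2:
  "T_map w (mat2 p q r s, mat2 u 0 v 0, c) =
    bit_scale R p f \<oplus> bit_scale R q b \<oplus> bit_scale R r a \<oplus> bit_scale R s g \<oplus>
    bit_scale R u w \<oplus> bit_scale R v (a \<otimes> w) \<oplus> bit_scale R c h"
  by (simp add: T_map_def)

context
  fixes w
  assumes fin: "finite (carrier R)" and order_le: "order R \<le> 128"
    and w: "w \<in> peirce R f h" "w \<noteq> \<zero>"
begin

lemma w_closed: "w \<in> carrier R" "a \<otimes> w \<in> carrier R" and fw: "f \<otimes> w = w" and wh: "w \<otimes> h = w"
  using w by (simp_all add: mem_peirce_fh)

lemma h_nonzero: "h \<noteq> \<zero>"
  using w(2) wh w_closed by auto

text \<open>The nonzero elements \<open>f\<close>, \<open>w\<close> and \<open>h\<close> show that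
  three components have at least two elements, and the bound 128 admits no more.\<close>

lemma T_card:
  "card (peirce R f f) = 2" "card (peirce R f h) = 2" "card (peirce R h h) = 2" "order R = 128"
proof -
  have "2 \<le> card (peirce R f f)"
    by (rule card_peirce_ge_2[of f f f]) (simp_all add: fin ff f_nonzero mem_peirce_ff)
  moreover have "2 \<le> card (peirce R f h)"
    by (rule card_peirce_ge_2[of f h w]) (simp_all add: fin ff hh w)
  moreover have "2 \<le> card (peirce R h h)"
    by (rule card_peirce_ge_2[of h h h]) (simp_all add: fin hh h_nonzero mem_peirce_hh)
  moreover have "1 \<le> card (peirce R h f)"
    by (rule card_peirce_ge_1) (simp_all add: fin ff hh)
  ultimately show "card (peirce R f f) = 2" "card (peirce R f h) = 2" "card (peirce R h h) = 2"
    "order R = 128"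
    using peirce_card_bound[of "card (peirce R f f)" "card (peirce R f h)" "card (peirce R h f)"
        "card (peirce R h h)"] order_le unfolding order_eq_peirce by blast+
qed

text \<open>Two-element components give the claim for \<open>f\<close>, \<open>w\<close> and
  \<open>h\<close>; it passes to the others through \<open>b = f b\<close>, \<open>a = a f\<close>,
  \<open>g = a b\<close> and the product \<open>a w\<close>.\<close>

lemma T_char_2:
  "f \<oplus> f = \<zero>" "b \<oplus> b = \<zero>" "a \<oplus> a = \<zero>" "g \<oplus> g = \<zero>" "w \<oplus> w = \<zero>"
  "a \<otimes> w \<oplus> a \<otimes> w = \<zero>" "h \<oplus> h = \<zero>"
proof -
  show f2: "f \<oplus> f = \<zero>"
    using card_peirce_2_char_2[of f f f] fin T_card(1) by (simp add: ff mem_peirce_ff f_nonzero)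
  show w2: "w \<oplus> w = \<zero>"
    using card_peirce_2_char_2[of f h w] fin T_card(2) w by (simp add: ff hh)
  show "h \<oplus> h = \<zero>"
    using card_peirce_2_char_2[of h h h] fin T_card(3) by (simp add: hh mem_peirce_hh h_nonzero)
  show "b \<oplus> b = \<zero>"
    using l_distr[of f f b] f2 by (simp add: fb)
  show a2: "a \<oplus> a = \<zero>"
    using r_distr[of f f a] f2 by (simp add: af)
  show "g \<oplus> g = \<zero>"
    using l_distr[of a a b] a2 by (simp add: g_def)
  show "a \<otimes> w \<oplus> a \<otimes> w = \<zero>"
    using l_distr[of a a w] a2 w_closed by simp
qed

text \<open>Since \<open>w = f w = w h\<close>, a product \<open>x w\<close> vanishes with
  \<open>x f\<close>, and \<open>w x\<close> vanishes with \<open>h x\<close>.\<close>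

lemma w_mult:
  "b \<otimes> w = \<zero>" "g \<otimes> w = \<zero>" "h \<otimes> w = \<zero>"
  "w \<otimes> f = \<zero>" "w \<otimes> b = \<zero>" "w \<otimes> a = \<zero>" "w \<otimes> g = \<zero>" "w \<otimes> w = \<zero>"
proof -
  have left: "x \<otimes> w = \<zero>" if "x \<in> carrier R" "x \<otimes> f = \<zero>" for x
    using mult_assoc_rule[OF that(2) that(1) _ w_closed(1)] w_closed by (simp add: fw)
  have right: "w \<otimes> x = \<zero>" if "x \<in> carrier R" "h \<otimes> x = \<zero>" for x
    using m_assoc[of w h x] that w_closed by (simp add: wh)
  show "b \<otimes> w = \<zero>" "g \<otimes> w = \<zero>" and hw: "h \<otimes> w = \<zero>"
    by (rule left; simp add: peirce_mult)+
  show "w \<otimes> f = \<zero>" "w \<otimes> b = \<zero>" "w \<otimes> a = \<zero>" "w \<otimes> g = \<zero>" "w \<otimes> w = \<zero>"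
    by (rule right; simp add: peirce_mult hw w_closed)+
qed

lemmas T_mult = peirce_mult fw wh w_mult
lemmas T_mult' = T_mult[THEN mult_assoc_rule]

lemma T_map_closed: "x \<in> carrier T_F2 \<Longrightarrow> T_map w x \<in> carrier R"
  using w_closed by (auto simp: T_F2_simps T_map_mat2)

lemma T_map_add:
  assumes "x \<in> carrier T_F2" "y \<in> carrier T_F2"
  shows "T_map w (x \<oplus>\<^bsub>T_F2\<^esub> y) = T_map w x \<oplus> T_map w y"
proof -
  obtain p q r s u v c where x: "x = (mat2 p q r s, mat2 u 0 v 0, c)"
    using assms(1) by (auto simp: T_F2_simps)
  obtain p' q' r' s' u' v' c' where y: "y = (mat2 p' q' r' s', mat2 u' 0 v' 0, c')"
    using assms(2) by (auto simp: T_F2_simps)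
  show ?thesis
    by (simp add: x y T_F2_simps T_map_mat2 w_closed bit_scale_add T_char_2 a_ac)
qed

lemma T_map_mult:
  assumes "x \<in> carrier T_F2" "y \<in> carrier T_F2"
  shows "T_map w (x \<otimes>\<^bsub>T_F2\<^esub> y) = T_map w x \<otimes> T_map w y"
proof -
  obtain p q r s u v c where x: "x = (mat2 p q r s, mat2 u 0 v 0, c)"
    using assms(1) by (auto simp: T_F2_simps)
  obtain p' q' r' s' u' v' c' where y: "y = (mat2 p' q' r' s', mat2 u' 0 v' 0, c')"
    using assms(2) by (auto simp: T_F2_simps)
  show ?thesis
    by (simp add: x y T_F2_simps T_map_mat2 w_closed l_distr r_distr bit_scale_mult m_assoc
        T_mult T_mult' bit_scale_add T_char_2 a_ac mult.commute)
qed

lemma T_map_one: "T_map w \<one>\<^bsub>T_F2\<^esub> = \<one>"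
  using decompose_one by (simp add: T_F2_simps T_map_mat2 w_closed)

lemma inj_T_map: "inj_on (T_map w) (carrier T_F2)"
proof (rule inj_onI)
  fix x y
  assume "x \<in> carrier T_F2" "y \<in> carrier T_F2" and eq: "T_map w x = T_map w y"
  then obtain p q r s u v c p' q' r' s' u' v' c'
    where x: "x = (mat2 p q r s, mat2 u 0 v 0, c)" and y: "y = (mat2 p' q' r' s', mat2 u' 0 v' 0, c')"
    unfolding T_F2_simps by blast
  note inj = bit_scale_inject[OF f_nonzero] bit_scale_inject[OF w(2)] bit_scale_inject[OF h_nonzero]
  note distr = l_distr r_distr bit_scale_lmult bit_scale_rmult m_assoc w_closed T_mult T_mult'
  have "k \<otimes> T_map w x \<otimes> l = k \<otimes> T_map w y \<otimes> l" for k l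
    by (simp add: eq)
  \<comment> \<open>Each pair of outer factors isolates one bit: \<open>p, q, r, s\<close> appear as
    multiples of \<open>f\<close> (using \<open>b a = f\<close>), \<open>u\<close> and
    \<open>v\<close> as multiples of \<open>w\<close>, and \<open>c\<close> as a multiple of
    \<open>h\<close>.\<close>
  from this[of f f] this[of f a] this[of b f] this[of b a] this[of f h] this[of b h] this[of h h]
  show "x = y"
    unfolding x y T_map_mat2 by (simp add: distr inj)
qed

lemma iso_T_F2: "order R = 128" "R \<simeq> T_F2"
proof -
  show order: "order R = 128"
    by (rule T_card)
  have "T_map w \<in> ring_iso T_F2 R"
  proof (rule ring_iso_memI)
    show "bij_betw (T_map w) (carrier T_F2) (carrier R)"
      using order order_T_F2 T_map_closed
      by (intro bij_betw_inj_card inj_T_map fin) (auto simp: order_def)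
  qed (simp_all add: T_map_closed T_map_add T_map_mult T_map_one)
  then show "R \<simeq> T_F2"
    using ring_iso_sym[OF ring_T_F2] by (auto simp: is_ring_iso_def)
qed

end

end

section \<open>Vanishing off-diagonal components: the direct product\<close>

context matrix_units
begin

text \<open>If \<open>x\<close> differs from \<open>f\<close>, the component is exhausted by
  \<open>0\<close>, \<open>f\<close> and \<open>x\<close>, and the sum \<open>x + f\<close> can only
  be zero.\<close>

lemma peirce_ff_cases:
  assumes fin: "finite (carrier R)" and card3: "card (peirce R f f) \<le> 3"
    and x: "x \<in> peirce R f f" "x \<noteq> \<zero>"
  shows "x = f \<or> x = \<ominus> f"
proof (cases "x = f")
  case False
  have xc: "x \<in> carrier R"
    using x by (simp add: mem_peirce_ff)
  have fA: "f \<in> peirce R f f"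
    by (simp add: mem_peirce_ff ff)
  have sub: "{\<zero>, f, x} \<subseteq> peirce R f f"
    using fA x(1) by (simp add: ff)
  have "card {\<zero>, f, x} = 3"
    using False x(2) f_nonzero by simp
  with card3 sub have *: "peirce R f f = {\<zero>, f, x}"
    by (intro card_seteq[symmetric] finite_peirce fin) (simp_all add: ff)
  have "x \<oplus> f \<in> peirce R f f"
    using fA x(1) ff by (simp add: add_mem_peirce)
  then have "x \<oplus> f = \<zero> \<or> x \<oplus> f = f \<or> x \<oplus> f = x"
    by (simp add: *)
  then have "x \<oplus> f = \<zero>"
    using xc x(2) f_nonzero by auto
  then show ?thesis
    using xc by (metis minus_equality units_closed(1))
qed simp

lemma peirce_ff_no_zero_divisors:
  assumes "finite (carrier R)" "card (peirce R f f) \<le> 3"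
    and "x \<in> peirce R f f" "x \<noteq> \<zero>" "y \<in> peirce R f f" "y \<noteq> \<zero>"
  shows "x \<otimes> y \<noteq> \<zero>"
proof -
  have "\<ominus> f \<noteq> \<zero>"
    using f_nonzero by simp
  then show ?thesis
    using peirce_ff_cases[OF assms(1,2,3,4)] peirce_ff_cases[OF assms(1,2,5,6)] f_nonzero
    by (auto simp: l_minus r_minus ff)
qed

text \<open>Viewing the corner as matrices over \<open>f R f\<close>, the entries of
  \<open>s\<close> are \<open>c s d\<close> with \<open>c\<close> one of \<open>f, b\<close> and
  \<open>d\<close> one of \<open>f, a\<close>. If all four vanished, so would the corner part of
  \<open>s\<close>.\<close>

lemma nonzero_entry:
  assumes s: "s \<in> carrier R" and nz: "(f \<oplus> g) \<otimes> s \<otimes> (f \<oplus> g) \<noteq> \<zero>"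
  obtains c d where "c \<in> carrier R" "d \<in> carrier R" "f \<otimes> c = c" "d \<otimes> f = d" "c \<otimes> s \<otimes> d \<noteq> \<zero>"
proof -
  have "\<exists>c\<in>{f, b}. \<exists>d\<in>{f, a}. c \<otimes> s \<otimes> d \<noteq> \<zero>"
  proof (rule ccontr)
    assume "\<not> ?thesis"
    then have z: "f \<otimes> s \<otimes> f = \<zero>" "f \<otimes> s \<otimes> a = \<zero>" "b \<otimes> s \<otimes> f = \<zero>" "b \<otimes> s \<otimes> a = \<zero>"
      by auto
    have "(f \<oplus> g) \<otimes> s \<otimes> (f \<oplus> g) =
      f \<otimes> s \<otimes> f \<oplus> f \<otimes> s \<otimes> a \<otimes> b \<oplus> (a \<otimes> (b \<otimes> s \<otimes> f) \<oplus> a \<otimes> (b \<otimes> s \<otimes> a) \<otimes> b)"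
      using s by (simp add: g_def l_distr r_distr m_assoc a_ac)
    with nz z show False
      by simp
  qed
  then obtain c d where "c \<in> {f, b}" "d \<in> {f, a}" "c \<otimes> s \<otimes> d \<noteq> \<zero>"
    by blast
  then show thesis
    using that[of c d] af fb ff by auto
qed

context
  assumes fin: "finite (carrier R)" and order_le: "order R \<le> 128"
    and fh0: "peirce R f h = {\<zero>}" and hf0: "peirce R h f = {\<zero>}"
begin

text \<open>The components between \<open>g\<close> and \<open>h\<close> vanish along with those
  between \<open>f\<close> and \<open>h\<close>, because \<open>g = a f b\<close>. Hence
  \<open>s h = h s h = h s\<close>.\<close>

lemma h_central:
  assumes s: "s \<in> carrier R"
  shows "s \<otimes> h = h \<otimes> s"
proof -
  have fsh: "f \<otimes> r \<otimes> h = \<zero>" and hsf: "h \<otimes> r \<otimes> f = \<zero>" if "r \<in> carrier R" for r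
    using fh0 hf0 that by (auto simp: peirce_def)
  have gsh: "g \<otimes> s \<otimes> h = \<zero>"
  proof -
    have "g \<otimes> s \<otimes> h = a \<otimes> (f \<otimes> (b \<otimes> s) \<otimes> h)"
      using s by (simp add: g_def m_assoc mult_assoc_rule[OF fb])
    then show ?thesis
      using s by (simp add: fsh)
  qed
  have hsg: "h \<otimes> s \<otimes> g = \<zero>"
  proof -
    have "h \<otimes> s \<otimes> g = h \<otimes> (s \<otimes> a) \<otimes> f \<otimes> b"
      using s by (simp add: g_def m_assoc fb)
    then show ?thesis
      using s by (simp add: hsf)
  qed
  have "s \<otimes> h = (f \<oplus> g \<oplus> h) \<otimes> (s \<otimes> h)"
    using s by (simp add: decompose_one)
  also have "\<dots> = h \<otimes> s \<otimes> h"
    using s fsh[OF s] gsh by (simp add: l_distr m_assoc)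
  also have "\<dots> = (h \<otimes> s) \<otimes> (f \<oplus> g \<oplus> h)"
    using s hsf[OF s] hsg by (simp add: r_distr)
  finally show ?thesis
    using s by (simp add: decompose_one)
qed

text \<open>Already \<open>4^4 = 256\<close> exceeds 128.\<close>

lemma card_ff_le_3: "card (peirce R f f) \<le> 3" and
  split_order: "order R = card (peirce R f f) ^ 4 * card (peirce R h h)"
proof -
  show split: "order R = card (peirce R f f) ^ 4 * card (peirce R h h)"
    by (simp add: order_eq_peirce fh0 hf0 flip: power_mult)
  have "1 \<le> card (peirce R h h)"
    by (rule card_peirce_ge_1) (simp_all add: fin hh)
  then have "card (peirce R f f) ^ 4 * 1 \<le> 128"
    using order_le unfolding split by (meson le_trans mult_le_mono2)
  then show "card (peirce R f f) \<le> 3"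
    using power_mono[of 4 "card (peirce R f f)" 4] by (cases "card (peirce R f f) \<le> 3") auto
qed

text \<open>The corner \<open>(f + g) R (f + g)\<close> is a prime ring, so the failure of reflexivity takes place in
  the complementary direct factor \<open>h R h\<close>.\<close>

lemma corner_not_reflexive:
  assumes nr: "\<not> reflexive_ring R"
  shows "\<not> reflexive_ring (corner_ring R h)"
proof -
  obtain x y where xy [simp]: "x \<in> carrier R" "y \<in> carrier R" and yx: "y \<otimes> x \<noteq> \<zero>"
    and xry: "\<And>r. r \<in> carrier R \<Longrightarrow> x \<otimes> r \<otimes> y = \<zero>"
    using nonreflexiveE[OF nr] by blast
  define e where "e = f \<oplus> g"
  have [simp]: "e \<in> carrier R"
    by (simp add: e_def)
  have eh: "e \<oplus> h = \<one>"
    using decompose_one by (simp add: e_def)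
  have ee: "e \<otimes> e = e"
    by (simp add: e_def l_distr r_distr units_mult)
  have e_mult: "e \<otimes> s = s \<ominus> h \<otimes> s" "s \<otimes> e = s \<ominus> s \<otimes> h" if "s \<in> carrier R" for s
    using that by (simp_all add: e_def h_def minus_eq l_distr r_distr l_minus r_minus minus_add minus_minus r_neg
        flip: a_assoc)
  have e_central: "s \<otimes> e = e \<otimes> s" if "s \<in> carrier R" for s
    using that by (simp add: e_mult h_central)
  \<comment> \<open>Otherwise \<open>x\<close> and \<open>y\<close> have nonzero entries
    \<open>c' x d'\<close> and \<open>c y d\<close> in \<open>f R f\<close>. Their product is
    nonzero there, yet it contains the factor \<open>x (d' c) y\<close>, which is zero.\<close>
  have eyx: "e \<otimes> (y \<otimes> x) = \<zero>"
  proof (rule ccontr)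
    assume nz: "e \<otimes> (y \<otimes> x) \<noteq> \<zero>"
    have sandwich: "e \<otimes> s \<otimes> e = e \<otimes> s" if "s \<in> carrier R" for s
      using that by (simp add: e_central m_assoc) (simp add: ee flip: m_assoc)
    have "e \<otimes> (y \<otimes> x) = e \<otimes> y \<otimes> x"
      by (simp add: m_assoc)
    with nz have "e \<otimes> y \<otimes> e \<noteq> \<zero>"
      by (auto simp: sandwich)
    moreover have "e \<otimes> (y \<otimes> x) = y \<otimes> (e \<otimes> x)"
      by (metis e_central m_assoc xy \<open>e \<in> carrier R\<close>)
    with nz have "e \<otimes> x \<otimes> e \<noteq> \<zero>"
      by (auto simp: sandwich)
    ultimately obtain c d c' d' where
      c [simp]: "c \<in> carrier R" "d \<in> carrier R" "c' \<in> carrier R" "d' \<in> carrier R"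
      and fc: "f \<otimes> c = c" "d \<otimes> f = d" "f \<otimes> c' = c'" "d' \<otimes> f = d'"
      and cyd: "c \<otimes> y \<otimes> d \<noteq> \<zero>" and cxd: "c' \<otimes> x \<otimes> d' \<noteq> \<zero>"
      using nonzero_entry[of y] nonzero_entry[of x] by (metis e_def xy)
    have "c \<otimes> y \<otimes> d \<in> peirce R f f" "c' \<otimes> x \<otimes> d' \<in> peirce R f f"
      by (simp_all add: mem_peirce_ff m_assoc fc mult_assoc_rule[OF fc(1)] mult_assoc_rule[OF fc(3)])
    then have "(c' \<otimes> x \<otimes> d') \<otimes> (c \<otimes> y \<otimes> d) \<noteq> \<zero>"
      using peirce_ff_no_zero_divisors[OF fin card_ff_le_3] cyd cxd by blast
    moreover have "(c' \<otimes> x \<otimes> d') \<otimes> (c \<otimes> y \<otimes> d) = c' \<otimes> (x \<otimes> (d' \<otimes> c) \<otimes> y) \<otimes> d"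
      by (simp add: m_assoc)
    ultimately show False
      by (simp add: xry)
  qed
  show ?thesis
  proof (rule not_reflexive_ringI[where r = h])
    show "h \<otimes> x \<in> carrier (corner_ring R h)" "h \<otimes> y \<in> carrier (corner_ring R h)"
      by (simp_all add: mem_peirce_hh h_central m_assoc hh mult_assoc_rule[OF hh])
    show "h \<in> carrier (corner_ring R h)"
      by (simp add: mem_peirce_hh hh)
    show "h \<otimes> x \<otimes>\<^bsub>corner_ring R h\<^esub> s \<otimes>\<^bsub>corner_ring R h\<^esub> (h \<otimes> y) = \<zero>\<^bsub>corner_ring R h\<^esub>"
      if "s \<in> carrier (corner_ring R h)" for s
    proof -
      have s: "s \<in> carrier R"
        using that by (simp add: mem_peirce_hh)
      have "h \<otimes> x \<otimes> s \<otimes> (h \<otimes> y) = h \<otimes> (x \<otimes> (s \<otimes> h) \<otimes> y)"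
        using s by (simp add: m_assoc)
      then show ?thesis
        using s by (simp add: xry)
    qed
    have "y \<otimes> x = e \<otimes> (y \<otimes> x) \<oplus> h \<otimes> (y \<otimes> x)"
      using eh by (simp flip: l_distr)
    then have "h \<otimes> (y \<otimes> x) \<noteq> \<zero>"
      using yx eyx by auto
    moreover have "h \<otimes> y \<otimes> h \<otimes> (h \<otimes> x) = h \<otimes> (y \<otimes> x)"
    proof -
      have "h \<otimes> y \<otimes> h \<otimes> (h \<otimes> x) = h \<otimes> (y \<otimes> h) \<otimes> x"
        by (simp add: m_assoc mult_assoc_rule[OF hh])
      also have "\<dots> = (h \<otimes> h) \<otimes> y \<otimes> x"
        by (subst h_central) (simp_all add: m_assoc)
      finally show ?thesis
        by (simp add: hh m_assoc)
    qed
    ultimately show "h \<otimes> y \<otimes>\<^bsub>corner_ring R h\<^esub> h \<otimes>\<^bsub>corner_ring R h\<^esub> (h \<otimes> x) \<noteq> \<zero>\<^bsub>corner_ring R h\<^esub>"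
      by simp
  qed
qed

end

text \<open>In the second factor \<open>z\<close> and \<open>q\<close> are the images of
  \<open>E12\<close> and \<open>E22\<close>, so \<open>E11\<close> has to go to the complement
  \<open>h - q\<close> of \<open>q\<close> in the corner with unit \<open>h\<close>.\<close>

definition MU_map where
  "MU_map z q = (\<lambda>(A, U).
    bit_scale R (A $$ (0, 0)) f \<oplus> bit_scale R (A $$ (0, 1)) b \<oplus>
    bit_scale R (A $$ (1, 0)) a \<oplus> bit_scale R (A $$ (1, 1)) g \<oplus>
    bit_scale R (U $$ (0, 0)) (h \<ominus> q) \<oplus> bit_scale R (U $$ (0, 1)) z \<oplus> bit_scale R (U $$ (1, 1)) q)"

context
  fixes p z q
  assumes zq_mem: "z \<in> peirce R h h" "q \<in> peirce R h h" and z_nonzero: "z \<noteq> \<zero>"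
    and zq: "z \<otimes> q = z" and qz: "q \<otimes> z = \<zero>" and qq: "q \<otimes> q = q"
    and p_def: "p = h \<ominus> q"
    and f2: "f \<oplus> f = \<zero>" and corner2: "\<And>v. v \<in> peirce R h h \<Longrightarrow> v \<oplus> v = \<zero>"
begin

lemma zq_closed: "z \<in> carrier R" "q \<in> carrier R" "p \<in> carrier R"
  using zq_mem by (simp_all add: mem_peirce_hh p_def)

lemma p_mem: "p \<in> peirce R h h"
  using zq_mem zq_closed
  by (simp add: mem_peirce_hh p_def minus_eq l_distr r_distr l_minus r_minus hh)

lemma MU_char_2:
  "f \<oplus> f = \<zero>" "b \<oplus> b = \<zero>" "a \<oplus> a = \<zero>" "g \<oplus> g = \<zero>" "p \<oplus> p = \<zero>" "z \<oplus> z = \<zero>" "q \<oplus> q = \<zero>"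
proof -
  show "f \<oplus> f = \<zero>"
    by (rule f2)
  show "b \<oplus> b = \<zero>"
    using l_distr[of f f b] f2 by (simp add: fb)
  show a2: "a \<oplus> a = \<zero>"
    using r_distr[of f f a] f2 by (simp add: af)
  show "g \<oplus> g = \<zero>"
    using l_distr[of a a b] a2 by (simp add: g_def)
qed (intro corner2 zq_mem p_mem)+

lemma corner_mult_zero:
  assumes "v \<in> peirce R h h"
  shows "f \<otimes> v = \<zero>" "b \<otimes> v = \<zero>" "a \<otimes> v = \<zero>" "g \<otimes> v = \<zero>"
    "v \<otimes> f = \<zero>" "v \<otimes> b = \<zero>" "v \<otimes> a = \<zero>" "v \<otimes> g = \<zero>"
proof -
  have v: "v \<in> carrier R" "h \<otimes> v = v" "v \<otimes> h = v"
    using assms by (simp_all add: mem_peirce_hh)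
  have left: "x \<otimes> v = \<zero>" if "x \<in> carrier R" "x \<otimes> h = \<zero>" for x
    using mult_assoc_rule[OF that(2) that(1) _ v(1)] v by simp
  have right: "v \<otimes> x = \<zero>" if "x \<in> carrier R" "h \<otimes> x = \<zero>" for x
    using m_assoc[of v h x] that v by simp
  show "f \<otimes> v = \<zero>" "b \<otimes> v = \<zero>" "a \<otimes> v = \<zero>" "g \<otimes> v = \<zero>"
    by (rule left; simp add: peirce_mult)+
  show "v \<otimes> f = \<zero>" "v \<otimes> b = \<zero>" "v \<otimes> a = \<zero>" "v \<otimes> g = \<zero>"
    by (rule right; simp add: peirce_mult)+
qed

lemma pzq_mult:
  "p \<otimes> p = p" "p \<otimes> z = z" "p \<otimes> q = \<zero>" "z \<otimes> p = \<zero>" "z \<otimes> z = \<zero>" "z \<otimes> q = z"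
  "q \<otimes> p = \<zero>" "q \<otimes> z = \<zero>" "q \<otimes> q = q"
proof -
  have hm: "h \<otimes> z = z" "h \<otimes> q = q" "z \<otimes> h = z" "q \<otimes> h = q"
    using zq_mem by (simp_all add: mem_peirce_hh)
  show pq: "p \<otimes> q = \<zero>"
    using zq_closed by (simp add: p_def minus_eq l_distr l_minus hm qq r_neg)
  show "p \<otimes> p = p"
    using pq p_mem zq_closed
    by (subst (2) p_def) (simp add: minus_eq r_distr r_minus mem_peirce_hh)
  show "p \<otimes> z = z"
    using zq_closed by (simp add: p_def minus_eq l_distr l_minus hm qz)
  show "z \<otimes> p = \<zero>"
    using zq_closed by (simp add: p_def minus_eq r_distr r_minus hm zq r_neg)
  show "z \<otimes> z = \<zero>"
    using m_assoc[of z q z] zq_closed by (simp add: zq qz)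
  show "q \<otimes> p = \<zero>"
    using zq_closed by (simp add: p_def minus_eq r_distr r_minus hm qq r_neg)
qed (rule zq qz qq)+

lemmas MU_mult = units_mult corner_mult_zero[OF p_mem] corner_mult_zero[OF zq_mem(1)]
  corner_mult_zero[OF zq_mem(2)] pzq_mult
lemmas MU_mult' = MU_mult[THEN mult_assoc_rule]

lemma MU_map_mat2:
  "MU_map z q (mat2 i j k l, mat2 u v 0 w) =
    bit_scale R i f \<oplus> bit_scale R j b \<oplus> bit_scale R k a \<oplus> bit_scale R l g \<oplus>
    bit_scale R u p \<oplus> bit_scale R v z \<oplus> bit_scale R w q"
  by (simp add: MU_map_def p_def)

lemma MU_map_closed: "x \<in> carrier (RDirProd M2_F2 U2_F2) \<Longrightarrow> MU_map z q x \<in> carrier R"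
  using zq_closed by (auto simp: MU_simps MU_map_mat2)

lemma MU_map_add:
  assumes "x \<in> carrier (RDirProd M2_F2 U2_F2)" "y \<in> carrier (RDirProd M2_F2 U2_F2)"
  shows "MU_map z q (x \<oplus>\<^bsub>RDirProd M2_F2 U2_F2\<^esub> y) = MU_map z q x \<oplus> MU_map z q y"
proof -
  obtain i j k l u v w where x: "x = (mat2 i j k l, mat2 u v 0 w)"
    using assms(1) by (auto simp: MU_simps)
  obtain i' j' k' l' u' v' w' where y: "y = (mat2 i' j' k' l', mat2 u' v' 0 w')"
    using assms(2) by (auto simp: MU_simps)
  have "x \<oplus>\<^bsub>RDirProd M2_F2 U2_F2\<^esub> y =
    (mat2 (i + i') (j + j') (k + k') (l + l'), mat2 (u + u') (v + v') 0 (w + w'))"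
    by (simp add: x y MU_simps)
  then show ?thesis
    by (simp add: x y MU_map_mat2 zq_closed bit_scale_add MU_char_2 a_ac)
qed

lemma MU_map_mult:
  assumes "x \<in> carrier (RDirProd M2_F2 U2_F2)" "y \<in> carrier (RDirProd M2_F2 U2_F2)"
  shows "MU_map z q (x \<otimes>\<^bsub>RDirProd M2_F2 U2_F2\<^esub> y) = MU_map z q x \<otimes> MU_map z q y"
proof -
  obtain i j k l u v w where x: "x = (mat2 i j k l, mat2 u v 0 w)"
    using assms(1) by (auto simp: MU_simps)
  obtain i' j' k' l' u' v' w' where y: "y = (mat2 i' j' k' l', mat2 u' v' 0 w')"
    using assms(2) by (auto simp: MU_simps)
  have "x \<otimes>\<^bsub>RDirProd M2_F2 U2_F2\<^esub> y =
    (mat2 (i * i' + j * k') (i * j' + j * l') (k * i' + l * k') (k * j' + l * l'),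
     mat2 (u * u') (u * v' + v * w') 0 (w * w'))"
    by (simp add: x y MU_simps)
  then show ?thesis
    by (simp add: x y MU_map_mat2 zq_closed l_distr r_distr bit_scale_mult m_assoc
        MU_mult MU_mult' bit_scale_add MU_char_2 a_ac)
qed

lemma MU_map_one: "MU_map z q \<one>\<^bsub>RDirProd M2_F2 U2_F2\<^esub> = \<one>"
proof -
  have "p \<oplus> q = h"
    using zq_closed(2) by (simp add: p_def minus_eq a_assoc l_neg)
  then have "f \<oplus> g \<oplus> p \<oplus> q = \<one>"
    using decompose_one zq_closed by (simp add: a_assoc)
  then show ?thesis
    by (simp add: MU_simps MU_map_mat2 zq_closed)
qed

text \<open>Both act as an identity on the nonzero \<open>z\<close>:
  \<open>p z = z = z q\<close>.\<close>

lemma pq_nonzero: "p \<noteq> \<zero>" "q \<noteq> \<zero>"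
  using pzq_mult(2,6) z_nonzero zq_closed by auto

lemma inj_MU_map: "inj_on (MU_map z q) (carrier (RDirProd M2_F2 U2_F2))"
proof (rule inj_onI)
  fix x y
  assume "x \<in> carrier (RDirProd M2_F2 U2_F2)" "y \<in> carrier (RDirProd M2_F2 U2_F2)"
    and eq: "MU_map z q x = MU_map z q y"
  then obtain i j k l u v w i' j' k' l' u' v' w'
    where x: "x = (mat2 i j k l, mat2 u v 0 w)" and y: "y = (mat2 i' j' k' l', mat2 u' v' 0 w')"
    unfolding MU_simps by blast
  note inj = bit_scale_inject[OF f_nonzero] bit_scale_inject[OF z_nonzero]
    pq_nonzero[THEN bit_scale_inject]
  note distr = l_distr r_distr bit_scale_lmult bit_scale_rmult m_assoc zq_closed MU_mult MU_mult'
  have "c \<otimes> MU_map z q x \<otimes> d = c \<otimes> MU_map z q y \<otimes> d" for c d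
    by (simp add: eq)
  \<comment> \<open>The first four pairs read off the entries of the full matrix as multiples of
    \<open>f\<close>; the pairs from \<open>p\<close> and \<open>q\<close> read off
    \<open>u\<close>, \<open>v\<close> and \<open>w\<close> as multiples of \<open>p\<close>,
    \<open>z\<close> and \<open>q\<close>.\<close>
  from this[of f f] this[of f a] this[of b f] this[of b a] this[of p p] this[of p q] this[of q q]
  show "x = y"
    unfolding x y MU_map_mat2 by (simp add: distr inj)
qed

lemma iso_MU:
  assumes "order R = 128" "finite (carrier R)"
  shows "R \<simeq> RDirProd M2_F2 U2_F2"
proof -
  have "MU_map z q \<in> ring_iso (RDirProd M2_F2 U2_F2) R"
  proof (rule ring_iso_memI)
    show "bij_betw (MU_map z q) (carrier (RDirProd M2_F2 U2_F2)) (carrier R)"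
      using assms order_MU MU_map_closed
      by (intro bij_betw_inj_card inj_MU_map) (auto simp: order_def)
  qed (simp_all add: MU_map_closed MU_map_add MU_map_mult MU_map_one)
  then show ?thesis
    using ring_iso_sym[OF ring_MU] by (auto simp: is_ring_iso_def)
qed

end

text \<open>The order is the fourth power of the size of \<open>f R f\<close> times the size of
  \<open>h R h\<close>. The factors are at least \<open>2^4\<close> and 8, so both bounds are
  attained.\<close>

lemma split_case:
  assumes fin: "finite (carrier R)" and order_le: "order R \<le> 128"
    and fh0: "peirce R f h = {\<zero>}" and hf0: "peirce R h f = {\<zero>}"
    and nr: "\<not> reflexive_ring R"
  shows "order R = 128" "R \<simeq> RDirProd M2_F2 U2_F2"
proof -
  interpret C: ring "corner_ring R h"
    by (rule ring_corner) (simp_all add: hh)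
  have C_nr: "\<not> reflexive_ring (corner_ring R h)"
    by (rule corner_not_reflexive[OF fin order_le fh0 hf0 nr])
  have C_fin: "finite (carrier (corner_ring R h))"
    using fin by (simp add: finite_peirce hh)
  have B8: "8 \<le> card (peirce R h h)"
    using C.nonreflexive_order_ge[OF C_fin C_nr] by (simp add: order_def)
  have A2: "2 \<le> card (peirce R f f)"
    by (rule card_peirce_ge_2[of f f f]) (simp_all add: fin ff f_nonzero mem_peirce_ff)
  note split = split_order[OF fin order_le fh0 hf0]
  have "card (peirce R f f) ^ 4 * 8 \<le> card (peirce R f f) ^ 4 * card (peirce R h h)"
    using B8 by (intro mult_left_mono) auto
  then have "card (peirce R f f) ^ 4 \<le> 16"
    using order_le split by linarith
  \<comment> \<open>Three elements would already give \<open>3^4 = 81\<close>.\<close>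
  then have A: "card (peirce R f f) = 2"
    using power_mono[of 3 "card (peirce R f f)" 4] A2
    by (cases "3 \<le> card (peirce R f f)") auto
  then have B: "card (peirce R h h) = 8"
    using B8 order_le split by simp
  show order: "order R = 128"
    by (simp add: split A B)
  obtain z q where zq: "z \<in> peirce R h h" "q \<in> peirce R h h" "z \<noteq> \<zero>" "z \<otimes> q = z" "q \<otimes> z = \<zero>"
    "q \<otimes> q = q" "\<And>v. v \<in> peirce R h h \<Longrightarrow> v \<oplus> v = \<zero>"
    using C.nonreflexive_order_8[OF C_fin _ C_nr] B by (auto simp: order_def)
  have "f \<oplus> f = \<zero>"
    using card_peirce_2_char_2[of f f f] fin A by (simp add: ff mem_peirce_ff f_nonzero)
  then show "R \<simeq> RDirProd M2_F2 U2_F2"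
    using iso_MU[OF zq(1-6) refl _ zq(7) order fin] by blast
qed

end

section \<open>Duality and the final case distinction\<close>

lemma matrix_units_op:
  assumes "matrix_units R f a b"
  shows "matrix_units (op_ring R) f b a"
proof -
  interpret matrix_units R f a b
    by fact
  show ?thesis
    using ring_op by (auto simp: matrix_units_def matrix_units_axioms_def f_nonzero ff ba af fb fa bf)
qed

text \<open>Passing to the opposite ring exchanges \<open>e12\<close> and \<open>e21\<close> but
  keeps both diagonal units: \<open>g\<close> is the same product \<open>a b\<close> read backwards,
  and negation depends on the additive group alone.\<close>

lemma matrix_units_h_op:
  assumes "matrix_units R f a b"
  shows "matrix_units.h (op_ring R) f b a = matrix_units.h R f a b"
proof -
  interpret matrix_units R f a b
    by fact
  interpret op: matrix_units "op_ring R" f b a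
    by (rule matrix_units_op) fact
  have "\<ominus>\<^bsub>op_ring R\<^esub> x = \<ominus>\<^bsub>R\<^esub> x" for x
    by (simp add: a_inv_def op_ring_def)
  then show ?thesis
    by (simp add: op.h_def h_def op.g_def g_def a_minus_def)
qed

lemma (in ring) peirce_op:
  "p \<in> carrier R \<Longrightarrow> q \<in> carrier R \<Longrightarrow> peirce (op_ring R) p q = peirce R q p"
  by (simp add: peirce_def m_assoc)

lemma ring_iso_op:
  assumes "op_ring R \<simeq> S"
  shows "R \<simeq> op_ring S"
proof -
  obtain \<phi> where "\<phi> \<in> ring_iso (op_ring R) S"
    using assms by (auto simp: is_ring_iso_def)
  then have "\<phi> \<in> ring_iso R (op_ring S)"
    by (auto simp: ring_iso_def ring_hom_def)
  then show ?thesis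
    by (auto simp: is_ring_iso_def)
qed

lemma (in ring) classification:
  assumes fin: "finite (carrier R)" and NI: "\<not> NI_ring R" and nr: "\<not> reflexive_ring R"
    and order_le: "order R \<le> 128"
  shows "order R = 128 \<and> (R \<simeq> T_F2 \<or> R \<simeq> op_ring T_F2 \<or> R \<simeq> RDirProd M2_F2 U2_F2)"
proof -
  obtain f a b where "f \<in> carrier R" "a \<in> carrier R" "b \<in> carrier R" "f \<noteq> \<zero>" "f \<otimes> f = f"
    "b \<otimes> a = f" "a \<otimes> f = a" "f \<otimes> b = b" "f \<otimes> a = \<zero>" "b \<otimes> f = \<zero>"
    using not_NI_matrix_units[OF fin NI] by blast
  then have mu: "matrix_units R f a b"
    by (simp add: matrix_units_def matrix_units_axioms_def ring_axioms)
  interpret matrix_units R f a b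
    by (rule mu)
  have "\<zero> \<in> peirce R f h" "\<zero> \<in> peirce R h f"
    by (simp_all add: ff hh)
  then consider w where "w \<in> peirce R f h" "w \<noteq> \<zero>" | w where "w \<in> peirce R h f" "w \<noteq> \<zero>"
    | "peirce R f h = {\<zero>}" "peirce R h f = {\<zero>}"
    by blast
  then show ?thesis
  proof cases
    case 1
    then show ?thesis
      using iso_T_F2[OF fin order_le] by blast
  next
    case (2 w)
    interpret op: matrix_units "op_ring R" f b a
      by (rule matrix_units_op[OF mu])
    \<comment> \<open>Reversal turns the component \<open>h R f\<close> into the one from
      \<open>f\<close> to \<open>h\<close>, so the triangular case applies to the opposite
      ring.\<close>
    have "w \<in> peirce (op_ring R) f op.h"
      using 2(1) by (simp add: matrix_units_h_op[OF mu] peirce_op)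
    then have "order R = 128" "op_ring R \<simeq> T_F2"
      using op.iso_T_F2[of w] fin order_le 2(2) by simp_all
    then show ?thesis
      using ring_iso_op by blast
  next
    case 3
    then show ?thesis
      using split_case[OF fin order_le _ _ nr] by blast
  qed
qed

theorem theorem3p7:
  shows
    "(\<forall>Q :: ('a, 'm) ring_scheme.
        ring Q \<and> finite (carrier Q) \<and> \<not> NI_ring Q \<and> \<not> reflexive_ring Q \<longrightarrow> 128 \<le> order Q)
   \<and> (ring T_F2 \<and> order T_F2 = 128 \<and> \<not> NI_ring T_F2 \<and> \<not> reflexive_ring T_F2)
   \<and> (ring (op_ring T_F2) \<and> order (op_ring T_F2) = 128 \<and>
        \<not> NI_ring (op_ring T_F2) \<and> \<not> reflexive_ring (op_ring T_F2))
   \<and> (ring (RDirProd M2_F2 U2_F2) \<and> order (RDirProd M2_F2 U2_F2) = 128 \<and>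
        \<not> NI_ring (RDirProd M2_F2 U2_F2) \<and> \<not> reflexive_ring (RDirProd M2_F2 U2_F2))
   \<and> (\<forall>Q :: ('a, 'm) ring_scheme.
        ring Q \<and> order Q = 128 \<and> \<not> NI_ring Q \<and> \<not> reflexive_ring Q \<longrightarrow>
          Q \<simeq> T_F2 \<or> Q \<simeq> op_ring T_F2 \<or> Q \<simeq> RDirProd M2_F2 U2_F2)
   \<and> \<not> T_F2 \<simeq> op_ring T_F2
   \<and> \<not> T_F2 \<simeq> RDirProd M2_F2 U2_F2
   \<and> \<not> op_ring T_F2 \<simeq> RDirProd M2_F2 U2_F2"
proof (intro conjI allI impI pairwise_not_isomorphic)
  fix Q :: "('a, 'm) ring_scheme"
  assume "ring Q \<and> finite (carrier Q) \<and> \<not> NI_ring Q \<and> \<not> reflexive_ring Q"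
  \<comment> \<open>The classification covers all orders up to 128 and shows that such an order
    equals 128.\<close>
  then show "128 \<le> order Q"
    using ring.classification[of Q] by (metis linear)
next
  fix Q :: "('a, 'm) ring_scheme"
  assume Q: "ring Q \<and> order Q = 128 \<and> \<not> NI_ring Q \<and> \<not> reflexive_ring Q"
  \<comment> \<open>An infinite carrier has \<open>order\<close> 0, so the order 128 implies
    finiteness.\<close>
  then have "finite (carrier Q)"
    by (intro card_ge_0_finite) (simp add: order_def)
  with Q show "Q \<simeq> T_F2 \<or> Q \<simeq> op_ring T_F2 \<or> Q \<simeq> RDirProd M2_F2 U2_F2"
    using ring.classification[of Q] by simp
qed (simp_all add: ring_T_F2 order_T_F2 not_NI_T_F2 not_reflexive_T_F2 ring.ring_op ring_MU order_MU
    not_NI_MU not_reflexive_MU NI_op_ring_iff reflexive_op_ring_iff)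

end
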